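(* Let $R$ be a commutative noetherian ring with no homomorphic images isomorphic to $\mathbb F_2\times\mathbb F_2$. Then any automorphism-invariant $R$-module is quasi-injective.
   Context: Rings have an identity and modules are unitary; $\mathbb F_2$ is the field with two elements and $E(M)$ denotes the injective envelope of $M$. A module $M$ is automorphism-invariant if $f(M)\subseteq M$ for every automorphism $f$ of $E(M)$, and quasi-injective if $f(M)\subseteq M$ for every endomorphism $f$ of $E(M)$. *)

theory Defs
  imports "HOL-Algebra.Algebra"
begin

section \<open>Module homomorphisms\<close>

definition module_hom ::
  "('a, 'm) ring_scheme \<Rightarrow> ('a, 'b, 'k) module_scheme \<Rightarrow> ('a, 'c, 'l) module_scheme \<Rightarrow> ('b \<Rightarrow> 'c) set"
  where "module_hom R A B =
    {f. f \<in> carrier A \<rightarrow> carrier B \<and>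
        (\<forall>x\<in>carrier A. \<forall>y\<in>carrier A. f (x \<oplus>\<^bsub>A\<^esub> y) = f x \<oplus>\<^bsub>B\<^esub> f y) \<and>
        (\<forall>r\<in>carrier R. \<forall>x\<in>carrier A. f (r \<odot>\<^bsub>A\<^esub> x) = r \<odot>\<^bsub>B\<^esub> f x)}"

definition module_aut ::
  "('a, 'm) ring_scheme \<Rightarrow> ('a, 'b, 'k) module_scheme \<Rightarrow> ('b \<Rightarrow> 'b) set"
  where "module_aut R A = {f \<in> module_hom R A A. bij_betw f (carrier A) (carrier A)}"


section \<open>Injective modules\<close>

text \<open>HOL cannot quantify over all modules, of all types, inside a definition.  Injectivity is
  therefore first stated for modules \<open>A\<close>, \<open>B\<close> whose elements have a given type \<open>'c\<close>, and
  \<open>injective_module\<close> takes for \<open>'c\<close> the type of the elements of the ring.  The theorem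
  \<open>injective_module_imp_injective_wrt\<close> below shows that the lifting property then holds
  for modules over every type, so that no generality is lost.\<close>

definition injective_wrt ::
  "'c itself \<Rightarrow> ('a, 'm) ring_scheme \<Rightarrow> ('a, 'e, 'k) module_scheme \<Rightarrow> bool"
  where "injective_wrt T R E \<longleftrightarrow> module R E \<and>
    (\<forall>(A :: ('a, 'c) module) (B :: ('a, 'c) module) i f.
       module R A \<and> module R B \<and>
       i \<in> module_hom R A B \<and> inj_on i (carrier A) \<and> f \<in> module_hom R A E \<longrightarrow>
       (\<exists>g\<in>module_hom R B E. \<forall>x\<in>carrier A. g (i x) = f x))"

definition injective_module ::
  "('a, 'm) ring_scheme \<Rightarrow> ('a, 'e, 'k) module_scheme \<Rightarrow> bool"
  where "injective_module R E \<longleftrightarrow> injective_wrt TYPE('a) R E"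

definition ring_as_module :: "('a, 'm) ring_scheme \<Rightarrow> ('a, 'a) module"
  where "ring_as_module R =
    \<lparr>carrier = carrier R, monoid.mult = monoid.mult R, one = one R, ring.zero = ring.zero R, ring.add = ring.add R,
     smult = monoid.mult R\<rparr>"

lemma ring_as_module_simps [simp]:
  "carrier (ring_as_module R) = carrier R"
  "ring.add (ring_as_module R) = ring.add R"
  "ring.zero (ring_as_module R) = ring.zero R"
  "smult (ring_as_module R) = monoid.mult R"
  by (simp_all add: ring_as_module_def)

lemma module_ring_as_module:
  assumes "cring R" shows "module R (ring_as_module R)"
proof -
  interpret cring R by fact
  show ?thesis
  proof (rule moduleI)
    show "abelian_group (ring_as_module R)"
      by (rule abelian_groupI) (auto simp: a_ac intro: l_neg)
  qed (auto simp: assms l_distr r_distr m_assoc)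
qed

text \<open>Baer's argument.  Partial extensions are represented by their graphs.\<close>

definition partial_ext ::
  "('a, 'm) ring_scheme \<Rightarrow> ('a, 'c, 'k) module_scheme \<Rightarrow> ('a, 'e, 'l) module_scheme \<Rightarrow> ('c \<times> 'e) set \<Rightarrow> bool"
  where "partial_ext R B E G \<longleftrightarrow> G \<subseteq> carrier B \<times> carrier E \<and> single_valued G \<and>
    (\<forall>x u y v. (x, u) \<in> G \<and> (y, v) \<in> G \<longrightarrow> (x \<oplus>\<^bsub>B\<^esub> y, u \<oplus>\<^bsub>E\<^esub> v) \<in> G) \<and>
    (\<forall>r\<in>carrier R. \<forall>x u. (x, u) \<in> G \<longrightarrow> (r \<odot>\<^bsub>B\<^esub> x, r \<odot>\<^bsub>E\<^esub> u) \<in> G)"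

lemma partial_ext_Union:
  assumes ch: "subset.chain UNIV C" and ne: "C \<noteq> {}" and pe: "\<And>G. G \<in> C \<Longrightarrow> partial_ext R B E G"
  shows "partial_ext R B E (\<Union>C)"
proof -
  have common: "\<exists>G\<in>C. p \<in> G \<and> q \<in> G" if "p \<in> \<Union>C" "q \<in> \<Union>C" for p q
    using that ch unfolding subset_chain_def by blast
  show ?thesis
    unfolding partial_ext_def
  proof (intro conjI allI impI ballI)
    show "\<Union>C \<subseteq> carrier B \<times> carrier E"
      using pe unfolding partial_ext_def by blast
    show "single_valued (\<Union>C)"
    proof (rule single_valuedI)
      fix x y z assume "(x, y) \<in> \<Union>C" "(x, z) \<in> \<Union>C"
      then obtain G where "G \<in> C" "(x, y) \<in> G" "(x, z) \<in> G" using common by blast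
      then show "y = z" using pe[of G] unfolding partial_ext_def by (meson single_valuedD)
    qed
  next
    fix x u y v assume "(x, u) \<in> \<Union>C \<and> (y, v) \<in> \<Union>C"
    then obtain G where "G \<in> C" "(x, u) \<in> G" "(y, v) \<in> G" using common by blast
    then show "(x \<oplus>\<^bsub>B\<^esub> y, u \<oplus>\<^bsub>E\<^esub> v) \<in> \<Union>C"
      using pe[of G] unfolding partial_ext_def by blast
  next
    fix r x u assume "r \<in> carrier R" "(x, u) \<in> \<Union>C"
    then show "(r \<odot>\<^bsub>B\<^esub> x, r \<odot>\<^bsub>E\<^esub> u) \<in> \<Union>C"
      using pe unfolding partial_ext_def by blast
  qed
qed

lemma partial_ext_step:
  fixes R :: "('a, 'm) ring_scheme" and B :: "('a, 'c, 'k) module_scheme"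
    and E :: "('a, 'e, 'l) module_scheme"
  assumes inj: "injective_module R E" and B: "module R B" and G: "partial_ext R B E G"
    and zero: "(\<zero>\<^bsub>B\<^esub>, \<zero>\<^bsub>E\<^esub>) \<in> G" and b: "b \<in> carrier B"
  shows "\<exists>G'. partial_ext R B E G' \<and> G \<subseteq> G' \<and> b \<in> Domain G'"
proof -
  interpret B: module R B by fact
  have E: "module R E" using inj unfolding injective_module_def injective_wrt_def by blast
  interpret E: module R E by fact
  have GB: "x \<in> carrier B" and GE: "u \<in> carrier E" if "(x, u) \<in> G" for x u
    using G that unfolding partial_ext_def by blast+
  have Gadd: "(x \<oplus>\<^bsub>B\<^esub> y, u \<oplus>\<^bsub>E\<^esub> v) \<in> G" if "(x, u) \<in> G" "(y, v) \<in> G" for x u y v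
    using G that unfolding partial_ext_def by blast
  have Gsm: "(r \<odot>\<^bsub>B\<^esub> x, r \<odot>\<^bsub>E\<^esub> u) \<in> G" if "(x, u) \<in> G" "r \<in> carrier R" for r x u
    using G that unfolding partial_ext_def by blast
  have Gsv: "u = v" if "(x, u) \<in> G" "(x, v) \<in> G" for x u v
    using G that unfolding partial_ext_def by (meson single_valuedD)
  have Gneg: "(\<ominus>\<^bsub>B\<^esub> x, \<ominus>\<^bsub>E\<^esub> u) \<in> G" if "(x, u) \<in> G" for x u
    using Gsm[OF that, of "\<ominus>\<^bsub>R\<^esub> \<one>\<^bsub>R\<^esub>"] GB[OF that] GE[OF that]
      B.smult_l_minus[of "\<one>\<^bsub>R\<^esub>" x] E.smult_l_minus[of "\<one>\<^bsub>R\<^esub>" u] by simp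
  define I where "I = {r \<in> carrier R. r \<odot>\<^bsub>B\<^esub> b \<in> Domain G}"
  define h where "h r = (THE u. (r \<odot>\<^bsub>B\<^esub> b, u) \<in> G)" for r
  have h_eq: "h r = u" if "(r \<odot>\<^bsub>B\<^esub> b, u) \<in> G" for r u
    unfolding h_def using that Gsv by (intro the_equality) auto
  have hG: "(r \<odot>\<^bsub>B\<^esub> b, h r) \<in> G" if "r \<in> I" for r
    using that h_eq unfolding I_def by auto
  let ?R = "ring_as_module R"
  let ?I = "?R\<lparr>carrier := I\<rparr>"
  have RM: "module R ?R" by (rule module_ring_as_module) (rule B.is_cring)
  interpret RM: module R ?R by (rule RM)
  have I_add: "(r \<oplus>\<^bsub>R\<^esub> s) \<odot>\<^bsub>B\<^esub> b = r \<odot>\<^bsub>B\<^esub> b \<oplus>\<^bsub>B\<^esub> s \<odot>\<^bsub>B\<^esub> b" if "r \<in> I" "s \<in> I" for r s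
    using that b unfolding I_def by (auto simp: B.smult_l_distr)
  have I_sm: "(s \<otimes>\<^bsub>R\<^esub> r) \<odot>\<^bsub>B\<^esub> b = s \<odot>\<^bsub>B\<^esub> (r \<odot>\<^bsub>B\<^esub> b)" if "r \<in> I" "s \<in> carrier R" for r s
    using that b unfolding I_def by (auto simp: B.smult_assoc1)
  have IR: "I \<subseteq> carrier R" unfolding I_def by auto
  have I_sub: "submodule I R ?R"
  proof (rule RM.submoduleI)
    show "I \<subseteq> carrier ?R" using IR by simp
    show "\<zero>\<^bsub>?R\<^esub> \<in> I" using zero b unfolding I_def by auto
    show add: "r \<oplus>\<^bsub>?R\<^esub> s \<in> I" if "r \<in> I" "s \<in> I" for r s
      using I_add[OF that] Gadd[OF hG[OF that(1)] hG[OF that(2)]] IR that unfolding I_def by auto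
    show sm: "s \<odot>\<^bsub>?R\<^esub> r \<in> I" if "s \<in> carrier R" "r \<in> I" for r s
      using I_sm[OF that(2,1)] Gsm[OF hG[OF that(2)] that(1)] IR that unfolding I_def by auto
    show "\<ominus>\<^bsub>?R\<^esub> r \<in> I" if "r \<in> I" for r
    proof -
      have "\<ominus>\<^bsub>?R\<^esub> r = (\<ominus>\<^bsub>R\<^esub> \<one>\<^bsub>R\<^esub>) \<odot>\<^bsub>?R\<^esub> r"
        using RM.smult_l_minus[of "\<one>\<^bsub>R\<^esub>" r] that IR by (auto simp: subset_iff)
      then show ?thesis using sm[of "\<ominus>\<^bsub>R\<^esub> \<one>\<^bsub>R\<^esub>" r] that by simp
    qed
  qed
  have IM: "module R ?I" by (rule submodule.submodule_is_module[OF I_sub RM])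
  have id_hom: "(\<lambda>r. r) \<in> module_hom R ?I ?R"
    using IR unfolding module_hom_def by auto
  have h_hom: "h \<in> module_hom R ?I E"
    unfolding module_hom_def
  proof (intro CollectI conjI ballI)
    show "h \<in> carrier ?I \<rightarrow> carrier E" using hG GE by auto
    show "h (r \<oplus>\<^bsub>?I\<^esub> s) = h r \<oplus>\<^bsub>E\<^esub> h s" if "r \<in> carrier ?I" "s \<in> carrier ?I" for r s
      using that I_add[of r s] Gadd[OF hG hG, of r s] by (auto intro!: h_eq)
    show "h (s \<odot>\<^bsub>?I\<^esub> r) = s \<odot>\<^bsub>E\<^esub> h r" if "s \<in> carrier R" "r \<in> carrier ?I" for r s
      using that I_sm[of r s] Gsm[OF hG, of r s] by (auto intro!: h_eq)
  qed
  have "\<exists>g\<in>module_hom R ?R E. \<forall>x\<in>carrier ?I. g x = h x"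
  proof -
    have "inj_on (\<lambda>r. r) (carrier ?I)" by simp
    with inj IM RM id_hom h_hom show ?thesis
      unfolding injective_module_def injective_wrt_def by blast
  qed
  then obtain g where g: "g \<in> module_hom R ?R E" and gh: "\<And>r. r \<in> I \<Longrightarrow> g r = h r" by auto
  define e where "e = g \<one>\<^bsub>R\<^esub>"
  have e: "e \<in> carrier E" using g unfolding module_hom_def e_def by auto
  have ge: "g r = r \<odot>\<^bsub>E\<^esub> e" if "r \<in> carrier R" for r
  proof -
    have "g (r \<odot>\<^bsub>?R\<^esub> \<one>\<^bsub>R\<^esub>) = r \<odot>\<^bsub>E\<^esub> e"
      using g that unfolding module_hom_def e_def by (auto simp del: ring_as_module_simps(4))
    then show ?thesis using that by simp
  qed
  have key: "u = r \<odot>\<^bsub>E\<^esub> e" if "(r \<odot>\<^bsub>B\<^esub> b, u) \<in> G" "r \<in> carrier R" for r u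
    using h_eq[OF that(1)] gh[of r] ge[of r] that DomainI[OF that(1)] unfolding I_def by auto
  define G' where "G' = {(x \<oplus>\<^bsub>B\<^esub> r \<odot>\<^bsub>B\<^esub> b, u \<oplus>\<^bsub>E\<^esub> r \<odot>\<^bsub>E\<^esub> e) | x u r. (x, u) \<in> G \<and> r \<in> carrier R}"
  have G'I: "(x \<oplus>\<^bsub>B\<^esub> r \<odot>\<^bsub>B\<^esub> b, u \<oplus>\<^bsub>E\<^esub> r \<odot>\<^bsub>E\<^esub> e) \<in> G'" if "(x, u) \<in> G" "r \<in> carrier R" for x u r
    using that unfolding G'_def by blast
  have G'E: thesis if "(y, v) \<in> G'"
      "\<And>x u r. (x, u) \<in> G \<Longrightarrow> r \<in> carrier R \<Longrightarrow> y = x \<oplus>\<^bsub>B\<^esub> r \<odot>\<^bsub>B\<^esub> b \<Longrightarrow> v = u \<oplus>\<^bsub>E\<^esub> r \<odot>\<^bsub>E\<^esub> e \<Longrightarrow> thesis"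
    for y v thesis
    using that unfolding G'_def by blast
  have "partial_ext R B E G'"
    unfolding partial_ext_def
  proof (intro conjI allI impI ballI)
    show "G' \<subseteq> carrier B \<times> carrier E" using GB GE b e unfolding G'_def by auto
    show "single_valued G'"
    proof (rule single_valuedI)
      fix y v w assume "(y, v) \<in> G'" "(y, w) \<in> G'"
      then obtain x u r x' u' r' where 1: "(x, u) \<in> G" "r \<in> carrier R" "(x', u') \<in> G" "r' \<in> carrier R"
        and y: "y = x \<oplus>\<^bsub>B\<^esub> r \<odot>\<^bsub>B\<^esub> b" "y = x' \<oplus>\<^bsub>B\<^esub> r' \<odot>\<^bsub>B\<^esub> b"
        and vw: "v = u \<oplus>\<^bsub>E\<^esub> r \<odot>\<^bsub>E\<^esub> e" "w = u' \<oplus>\<^bsub>E\<^esub> r' \<odot>\<^bsub>E\<^esub> e"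
        by (metis G'E)
      note c = 1 GB[OF 1(1)] GB[OF 1(3)] GE[OF 1(1)] GE[OF 1(3)] b e
      have bs: "r \<odot>\<^bsub>B\<^esub> b \<in> carrier B" "r' \<odot>\<^bsub>B\<^esub> b \<in> carrier B"
        "r \<odot>\<^bsub>E\<^esub> e \<in> carrier E" "r' \<odot>\<^bsub>E\<^esub> e \<in> carrier E" using c by auto
      have eqB: "(r' \<oplus>\<^bsub>R\<^esub> \<ominus>\<^bsub>R\<^esub> r) \<odot>\<^bsub>B\<^esub> b = x \<oplus>\<^bsub>B\<^esub> \<ominus>\<^bsub>B\<^esub> x'"
      proof -
        have "(r' \<oplus>\<^bsub>R\<^esub> \<ominus>\<^bsub>R\<^esub> r) \<odot>\<^bsub>B\<^esub> b = r' \<odot>\<^bsub>B\<^esub> b \<oplus>\<^bsub>B\<^esub> \<ominus>\<^bsub>B\<^esub> (r \<odot>\<^bsub>B\<^esub> b)"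
          using c by (simp add: B.smult_l_distr B.smult_l_minus)
        also have "r' \<odot>\<^bsub>B\<^esub> b = \<ominus>\<^bsub>B\<^esub> x' \<oplus>\<^bsub>B\<^esub> (x \<oplus>\<^bsub>B\<^esub> r \<odot>\<^bsub>B\<^esub> b)"
          using y c bs by (metis B.M.r_neg1)
        also have "\<dots> \<oplus>\<^bsub>B\<^esub> \<ominus>\<^bsub>B\<^esub> (r \<odot>\<^bsub>B\<^esub> b) = x \<oplus>\<^bsub>B\<^esub> \<ominus>\<^bsub>B\<^esub> x'"
        proof -
          have "\<ominus>\<^bsub>B\<^esub> x' \<oplus>\<^bsub>B\<^esub> (x \<oplus>\<^bsub>B\<^esub> r \<odot>\<^bsub>B\<^esub> b) \<oplus>\<^bsub>B\<^esub> \<ominus>\<^bsub>B\<^esub> (r \<odot>\<^bsub>B\<^esub> b)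
              = (\<ominus>\<^bsub>B\<^esub> x' \<oplus>\<^bsub>B\<^esub> x) \<oplus>\<^bsub>B\<^esub> (r \<odot>\<^bsub>B\<^esub> b \<oplus>\<^bsub>B\<^esub> \<ominus>\<^bsub>B\<^esub> (r \<odot>\<^bsub>B\<^esub> b))"
            using c bs by (simp add: B.M.a_assoc)
          also have "\<dots> = \<ominus>\<^bsub>B\<^esub> x' \<oplus>\<^bsub>B\<^esub> x"
            using c bs by (simp add: B.M.r_neg)
          finally show ?thesis using c by (simp add: B.M.a_comm)
        qed
        finally show ?thesis .
      qed
      have "(x \<oplus>\<^bsub>B\<^esub> \<ominus>\<^bsub>B\<^esub> x', u \<oplus>\<^bsub>E\<^esub> \<ominus>\<^bsub>E\<^esub> u') \<in> G" using Gadd Gneg c by blast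
      then have "u \<oplus>\<^bsub>E\<^esub> \<ominus>\<^bsub>E\<^esub> u' = (r' \<oplus>\<^bsub>R\<^esub> \<ominus>\<^bsub>R\<^esub> r) \<odot>\<^bsub>E\<^esub> e"
        using key[of "r' \<oplus>\<^bsub>R\<^esub> \<ominus>\<^bsub>R\<^esub> r" "u \<oplus>\<^bsub>E\<^esub> \<ominus>\<^bsub>E\<^esub> u'"] eqB c by simp
      also have "\<dots> = r' \<odot>\<^bsub>E\<^esub> e \<oplus>\<^bsub>E\<^esub> \<ominus>\<^bsub>E\<^esub> (r \<odot>\<^bsub>E\<^esub> e)"
        using c by (simp add: E.smult_l_distr E.smult_l_minus)
      finally have d: "u \<oplus>\<^bsub>E\<^esub> \<ominus>\<^bsub>E\<^esub> u' = r' \<odot>\<^bsub>E\<^esub> e \<oplus>\<^bsub>E\<^esub> \<ominus>\<^bsub>E\<^esub> (r \<odot>\<^bsub>E\<^esub> e)" .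
      have "v = u' \<oplus>\<^bsub>E\<^esub> ((u \<oplus>\<^bsub>E\<^esub> \<ominus>\<^bsub>E\<^esub> u') \<oplus>\<^bsub>E\<^esub> r \<odot>\<^bsub>E\<^esub> e)"
        using c bs E.M.a_lcomm[of u' u "\<ominus>\<^bsub>E\<^esub> u' \<oplus>\<^bsub>E\<^esub> r \<odot>\<^bsub>E\<^esub> e"] unfolding vw
        by (simp add: E.M.a_assoc E.M.r_neg2)
      also have "\<dots> = w"
        using c bs unfolding vw d by (simp add: E.M.a_assoc E.M.l_neg)
      finally show "v = w" .
    qed
  next
    fix x1 v1 x2 v2 assume "(x1, v1) \<in> G' \<and> (x2, v2) \<in> G'"
    then obtain x u r x' u' r' where 1: "(x, u) \<in> G" "r \<in> carrier R" "(x', u') \<in> G" "r' \<in> carrier R"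
      and y: "x1 = x \<oplus>\<^bsub>B\<^esub> r \<odot>\<^bsub>B\<^esub> b" "x2 = x' \<oplus>\<^bsub>B\<^esub> r' \<odot>\<^bsub>B\<^esub> b"
      and vw: "v1 = u \<oplus>\<^bsub>E\<^esub> r \<odot>\<^bsub>E\<^esub> e" "v2 = u' \<oplus>\<^bsub>E\<^esub> r' \<odot>\<^bsub>E\<^esub> e"
      by (metis G'E)
    note c = 1 GB[OF 1(1)] GB[OF 1(3)] GE[OF 1(1)] GE[OF 1(3)] b e
    have bs: "r \<odot>\<^bsub>B\<^esub> b \<in> carrier B" "r' \<odot>\<^bsub>B\<^esub> b \<in> carrier B"
      "r \<odot>\<^bsub>E\<^esub> e \<in> carrier E" "r' \<odot>\<^bsub>E\<^esub> e \<in> carrier E" using c by auto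
    have "x1 \<oplus>\<^bsub>B\<^esub> x2 = (x \<oplus>\<^bsub>B\<^esub> x') \<oplus>\<^bsub>B\<^esub> (r \<oplus>\<^bsub>R\<^esub> r') \<odot>\<^bsub>B\<^esub> b"
      using c bs unfolding y by (simp add: B.smult_l_distr B.M.a_ac)
    moreover have "v1 \<oplus>\<^bsub>E\<^esub> v2 = (u \<oplus>\<^bsub>E\<^esub> u') \<oplus>\<^bsub>E\<^esub> (r \<oplus>\<^bsub>R\<^esub> r') \<odot>\<^bsub>E\<^esub> e"
      using c bs unfolding vw by (simp add: E.smult_l_distr E.M.a_ac)
    ultimately show "(x1 \<oplus>\<^bsub>B\<^esub> x2, v1 \<oplus>\<^bsub>E\<^esub> v2) \<in> G'"
      using G'I[OF Gadd[OF 1(1,3)], of "r \<oplus>\<^bsub>R\<^esub> r'"] 1 by simp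
  next
    fix s x1 v1 assume s: "s \<in> carrier R" and "(x1, v1) \<in> G'"
    then obtain x u r where 1: "(x, u) \<in> G" "r \<in> carrier R"
      and y: "x1 = x \<oplus>\<^bsub>B\<^esub> r \<odot>\<^bsub>B\<^esub> b" "v1 = u \<oplus>\<^bsub>E\<^esub> r \<odot>\<^bsub>E\<^esub> e"
      by (metis G'E)
    note c = 1 GB[OF 1(1)] GE[OF 1(1)] b e s
    have "s \<odot>\<^bsub>B\<^esub> x1 = s \<odot>\<^bsub>B\<^esub> x \<oplus>\<^bsub>B\<^esub> (s \<otimes>\<^bsub>R\<^esub> r) \<odot>\<^bsub>B\<^esub> b"
      using c unfolding y by (simp add: B.smult_r_distr B.smult_assoc1)
    moreover have "s \<odot>\<^bsub>E\<^esub> v1 = s \<odot>\<^bsub>E\<^esub> u \<oplus>\<^bsub>E\<^esub> (s \<otimes>\<^bsub>R\<^esub> r) \<odot>\<^bsub>E\<^esub> e"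
      using c unfolding y by (simp add: E.smult_r_distr E.smult_assoc1)
    ultimately show "(s \<odot>\<^bsub>B\<^esub> x1, s \<odot>\<^bsub>E\<^esub> v1) \<in> G'"
      using G'I[OF Gsm[OF 1(1) s], of "s \<otimes>\<^bsub>R\<^esub> r"] c by simp
  qed
  moreover have "G \<subseteq> G'"
  proof (rule subrelI)
    fix x u assume a: "(x, u) \<in> G"
    show "(x, u) \<in> G'"
      using G'I[OF a, of "\<zero>\<^bsub>R\<^esub>"] GB[OF a] GE[OF a] b e by simp
  qed
  moreover have "b \<in> Domain G'"
    using G'I[OF zero, of "\<one>\<^bsub>R\<^esub>"] b e by auto
  ultimately show ?thesis by blast
qed

theorem injective_module_imp_injective_wrt:
  fixes R :: "('a, 'm) ring_scheme" and E :: "('a, 'e, 'k) module_scheme"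
  assumes inj: "injective_module R E"
  shows "injective_wrt TYPE('c) R E"
  unfolding injective_wrt_def
proof (intro conjI allI impI)
  show E: "module R E" using inj unfolding injective_module_def injective_wrt_def by blast
  fix A B :: "('a, 'c) module" and i f
  assume H: "module R A \<and> module R B \<and> i \<in> module_hom R A B \<and> inj_on i (carrier A) \<and> f \<in> module_hom R A E"
  interpret A: module R A using H by blast
  interpret B: module R B using H by blast
  interpret E: module R E by fact
  have i: "\<And>x. x \<in> carrier A \<Longrightarrow> i x \<in> carrier B"
    "\<And>x y. x \<in> carrier A \<Longrightarrow> y \<in> carrier A \<Longrightarrow> i (x \<oplus>\<^bsub>A\<^esub> y) = i x \<oplus>\<^bsub>B\<^esub> i y"
    "\<And>r x. r \<in> carrier R \<Longrightarrow> x \<in> carrier A \<Longrightarrow> i (r \<odot>\<^bsub>A\<^esub> x) = r \<odot>\<^bsub>B\<^esub> i x"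
    using H unfolding module_hom_def by auto
  have f: "\<And>x. x \<in> carrier A \<Longrightarrow> f x \<in> carrier E"
    "\<And>x y. x \<in> carrier A \<Longrightarrow> y \<in> carrier A \<Longrightarrow> f (x \<oplus>\<^bsub>A\<^esub> y) = f x \<oplus>\<^bsub>E\<^esub> f y"
    "\<And>r x. r \<in> carrier R \<Longrightarrow> x \<in> carrier A \<Longrightarrow> f (r \<odot>\<^bsub>A\<^esub> x) = r \<odot>\<^bsub>E\<^esub> f x"
    using H unfolding module_hom_def by auto
  define G0 where "G0 = {(i x, f x) | x. x \<in> carrier A}"
  have G0: "partial_ext R B E G0"
    unfolding partial_ext_def
  proof (intro conjI allI impI ballI)
    show "G0 \<subseteq> carrier B \<times> carrier E" using i(1) f(1) unfolding G0_def by auto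
    show "single_valued G0"
      using H unfolding G0_def single_valued_def inj_on_def by blast
  next
    fix x u y v assume "(x, u) \<in> G0 \<and> (y, v) \<in> G0"
    then obtain p q where "p \<in> carrier A" "q \<in> carrier A" "x = i p" "u = f p" "y = i q" "v = f q"
      unfolding G0_def by blast
    then show "(x \<oplus>\<^bsub>B\<^esub> y, u \<oplus>\<^bsub>E\<^esub> v) \<in> G0"
      using i(2)[of p q] f(2)[of p q] unfolding G0_def by (intro CollectI exI[of _ "p \<oplus>\<^bsub>A\<^esub> q"]) simp
  next
    fix r x u assume "r \<in> carrier R" "(x, u) \<in> G0"
    then obtain p where "p \<in> carrier A" "x = i p" "u = f p" "r \<in> carrier R"
      unfolding G0_def by blast
    then show "(r \<odot>\<^bsub>B\<^esub> x, r \<odot>\<^bsub>E\<^esub> u) \<in> G0"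
      using i(3)[of r p] f(3)[of r p] unfolding G0_def by (intro CollectI exI[of _ "r \<odot>\<^bsub>A\<^esub> p"]) simp
  qed
  have z: "(\<zero>\<^bsub>B\<^esub>, \<zero>\<^bsub>E\<^esub>) \<in> G0"
  proof -
    have "i \<zero>\<^bsub>A\<^esub> = \<zero>\<^bsub>B\<^esub>" "f \<zero>\<^bsub>A\<^esub> = \<zero>\<^bsub>E\<^esub>"
      using i(3)[of "\<zero>\<^bsub>R\<^esub>" "\<zero>\<^bsub>A\<^esub>"] f(3)[of "\<zero>\<^bsub>R\<^esub>" "\<zero>\<^bsub>A\<^esub>"] i(1) f(1) by simp_all
    then show ?thesis unfolding G0_def by (metis (mono_tags, lifting) A.M.zero_closed mem_Collect_eq)
  qed
  define \<F> where "\<F> = {G. partial_ext R B E G \<and> G0 \<subseteq> G}"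
  have "\<exists>M\<in>\<F>. \<forall>Y\<in>\<F>. M \<subseteq> Y \<longrightarrow> Y = M"
  proof (rule subset_Zorn_nonempty)
    show "\<F> \<noteq> {}" using G0 unfolding \<F>_def by blast
    fix C assume "C \<noteq> {}" "subset.chain \<F> C"
    then show "\<Union>C \<in> \<F>"
      using partial_ext_Union[of C R B E] unfolding \<F>_def subset_chain_def by blast
  qed
  then obtain G where G_in: "G \<in> \<F>" and G_max: "\<forall>Y\<in>\<F>. G \<subseteq> Y \<longrightarrow> Y = G" ..
  have G: "partial_ext R B E G" "G0 \<subseteq> G"
    using G_in unfolding \<F>_def by auto
  have max: "Y = G" if "partial_ext R B E Y" "G \<subseteq> Y" for Y
    using that G(2) G_max unfolding \<F>_def by auto
  have dom: "\<exists>u. (b, u) \<in> G" if b: "b \<in> carrier B" for b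
    using partial_ext_step[OF inj B.module_axioms G(1) _ b] z G max by blast
  have sv: "u = v" if "(x, u) \<in> G" "(x, v) \<in> G" for x u v
    using G that unfolding partial_ext_def by (meson single_valuedD)
  define g where "g b = (THE u. (b, u) \<in> G)" for b
  have g_eq: "g b = u" if "(b, u) \<in> G" for b u
    unfolding g_def using that sv by (intro the_equality) auto
  have gG: "(b, g b) \<in> G" if "b \<in> carrier B" for b
    using dom[OF that] g_eq by auto
  have "g \<in> module_hom R B E"
    using G(1) gG unfolding module_hom_def partial_ext_def by (auto intro!: g_eq)
  moreover have "g (i x) = f x" if "x \<in> carrier A" for x
    using that G(2) unfolding G0_def by (intro g_eq) blast
  ultimately show "\<exists>g\<in>module_hom R B E. \<forall>x\<in>carrier A. g (i x) = f x" by blast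
qed


section \<open>Injective envelopes and invariance\<close>

text \<open>\<open>E\<close> is an injective envelope of \<open>M\<close> via the embedding \<open>j\<close> if \<open>E\<close> is injective and the
  image of \<open>j\<close> is essential in \<open>E\<close>, i.e. meets every nonzero submodule nontrivially.  The pair
  \<open>(E, j)\<close> is unique up to isomorphism; the notions below take it as an argument, and \<open>M\<close> is
  identified with its image under \<open>j\<close>.\<close>

definition injective_envelope ::
  "('a, 'm) ring_scheme \<Rightarrow> ('a, 'b, 'k) module_scheme \<Rightarrow> ('a, 'e, 'l) module_scheme \<Rightarrow> ('b \<Rightarrow> 'e) \<Rightarrow> bool"
  where "injective_envelope R M E j \<longleftrightarrow>
    injective_module R E \<and> j \<in> module_hom R M E \<and> inj_on j (carrier M) \<and>
    (\<forall>N. submodule N R E \<and> N \<noteq> {\<zero>\<^bsub>E\<^esub>} \<longrightarrow> N \<inter> j ` carrier M \<noteq> {\<zero>\<^bsub>E\<^esub>})"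

definition automorphism_invariant ::
  "('a, 'm) ring_scheme \<Rightarrow> ('a, 'b, 'k) module_scheme \<Rightarrow> ('a, 'e, 'l) module_scheme \<Rightarrow> ('b \<Rightarrow> 'e) \<Rightarrow> bool"
  where "automorphism_invariant R M E j \<longleftrightarrow>
    (\<forall>f\<in>module_aut R E. f ` (j ` carrier M) \<subseteq> j ` carrier M)"

definition quasi_injective ::
  "('a, 'm) ring_scheme \<Rightarrow> ('a, 'b, 'k) module_scheme \<Rightarrow> ('a, 'e, 'l) module_scheme \<Rightarrow> ('b \<Rightarrow> 'e) \<Rightarrow> bool"
  where "quasi_injective R M E j \<longleftrightarrow>
    (\<forall>f\<in>module_hom R E E. f ` (j ` carrier M) \<subseteq> j ` carrier M)"


section \<open>Homomorphic images of rings\<close>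

definition has_homomorphic_image :: "('a, 'm) ring_scheme \<Rightarrow> ('b, 'n) ring_scheme \<Rightarrow> bool"
  where "has_homomorphic_image R S \<longleftrightarrow> (\<exists>I. ideal I R \<and> R Quot I \<simeq> S)"

end

theory Submission
  imports Defs
begin

text \<open>Let \<open>N\<close> be an automorphism-invariant submodule of the injective module \<open>E\<close>, and let \<open>A\<close> be the
  ring of the endomorphisms of \<open>E\<close> that preserve \<open>N\<close>.  It contains all automorphisms, hence all
  endomorphisms of square zero, in particular \<open>e f (1 - e)\<close> and \<open>(1 - e) f e\<close> for idempotent \<open>e\<close>.

  Let \<open>e\<close> project onto the injective hull of some \<open>R x\<close> with \<open>p = Ann x\<close> prime.  The image is
  uniform, so each endomorphism of it, or its difference from the identity, is bijective.
  Therefore \<open>e f e \<in> A\<close> for all \<open>f\<close> as soon as \<open>e \<in> A\<close>.  If some \<open>r\<close> satisfies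
  \<open>r, r - 1 \<notin> p\<close>, then \<open>r e + (1 - e)\<close> and \<open>(r - 1) e + (1 - e)\<close> are automorphisms, which gives
  \<open>e \<in> A\<close>.  Otherwise \<open>R/p\<close> has two elements.  If \<open>(1 - e) E\<close> contains a copy of \<open>R/p\<close>, then
  \<open>e\<close> is, up to an automorphism, a product of two off-diagonal maps.  If not, then all other
  associated primes that occur in \<open>(1 - e) E\<close> are of the first kind, because \<open>R\<close> does not map onto
  \<open>F\<^sub>2 \<times> F\<^sub>2\<close>, and \<open>(1 - e) n \<in> N\<close> for \<open>n \<in> N\<close> by noetherian induction on \<open>Ann ((1 - e) n)\<close>.

  Hence \<open>e \<in> A\<close> in all cases.  For arbitrary \<open>f\<close> and \<open>n \<in> N\<close>, splitting off \<open>e n\<close>, where \<open>e\<close> belongs to an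
  associated prime of \<open>R n\<close>, enlarges the annihilator, and \<open>f n \<in> N\<close> follows by noetherian
  induction on \<open>Ann n\<close>.\<close>

section \<open>Endomorphisms of modules\<close>

context module
begin

section \<open>Sums, differences and composites of endomorphisms\<close>

lemma hom_closed [simp]:
  "f \<in> module_hom R M M \<Longrightarrow> x \<in> carrier M \<Longrightarrow> f x \<in> carrier M"
  unfolding module_hom_def by auto

lemma hom_add [simp]:
  "f \<in> module_hom R M M \<Longrightarrow> x \<in> carrier M \<Longrightarrow> y \<in> carrier M \<Longrightarrow>
    f (x \<oplus>\<^bsub>M\<^esub> y) = f x \<oplus>\<^bsub>M\<^esub> f y"
  unfolding module_hom_def by auto

lemma hom_smult [simp]:
  "f \<in> module_hom R M M \<Longrightarrow> r \<in> carrier R \<Longrightarrow> x \<in> carrier M \<Longrightarrow>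
    f (r \<odot>\<^bsub>M\<^esub> x) = r \<odot>\<^bsub>M\<^esub> f x"
  unfolding module_hom_def by auto

lemma hom_zero [simp]: "f \<in> module_hom R M M \<Longrightarrow> f \<zero>\<^bsub>M\<^esub> = \<zero>\<^bsub>M\<^esub>"
  using hom_smult[of f "\<zero>" "\<zero>\<^bsub>M\<^esub>"] by simp

lemma hom_neg [simp]:
  assumes "f \<in> module_hom R M M" "x \<in> carrier M"
  shows "f (\<ominus>\<^bsub>M\<^esub> x) = \<ominus>\<^bsub>M\<^esub> f x"
  using hom_smult[OF assms(1), of "\<ominus> \<one>" x] assms by (simp add: smult_l_minus)

lemma hom_minus [simp]:
  "f \<in> module_hom R M M \<Longrightarrow> x \<in> carrier M \<Longrightarrow> y \<in> carrier M \<Longrightarrow>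
    f (x \<ominus>\<^bsub>M\<^esub> y) = f x \<ominus>\<^bsub>M\<^esub> f y"
  by (simp add: a_minus_def)

lemma smult_r_diff:
  "r \<in> carrier R \<Longrightarrow> x \<in> carrier M \<Longrightarrow> y \<in> carrier M \<Longrightarrow>
    r \<odot>\<^bsub>M\<^esub> (x \<ominus>\<^bsub>M\<^esub> y) = r \<odot>\<^bsub>M\<^esub> x \<ominus>\<^bsub>M\<^esub> r \<odot>\<^bsub>M\<^esub> y"
  by (simp add: a_minus_def smult_r_distr smult_r_minus)

lemma smult_l_diff:
  "r \<in> carrier R \<Longrightarrow> s \<in> carrier R \<Longrightarrow> x \<in> carrier M \<Longrightarrow>
    (r \<ominus> s) \<odot>\<^bsub>M\<^esub> x = r \<odot>\<^bsub>M\<^esub> x \<ominus>\<^bsub>M\<^esub> s \<odot>\<^bsub>M\<^esub> x"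
  by (simp add: a_minus_def smult_l_distr smult_l_minus)

lemma smult_commute:
  "r \<in> carrier R \<Longrightarrow> s \<in> carrier R \<Longrightarrow> x \<in> carrier M \<Longrightarrow>
    r \<odot>\<^bsub>M\<^esub> (s \<odot>\<^bsub>M\<^esub> x) = s \<odot>\<^bsub>M\<^esub> (r \<odot>\<^bsub>M\<^esub> x)"
  by (metis smult_assoc1 R.m_comm)

lemma diff_self [simp]: "x \<in> carrier M \<Longrightarrow> x \<ominus>\<^bsub>M\<^esub> x = \<zero>\<^bsub>M\<^esub>"
  by (simp add: a_minus_def M.r_neg)

lemma diff_zero [simp]: "x \<in> carrier M \<Longrightarrow> x \<ominus>\<^bsub>M\<^esub> \<zero>\<^bsub>M\<^esub> = x"
  by (simp add: a_minus_def)

lemma add_diff_cancel [simp]: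
  "x \<in> carrier M \<Longrightarrow> y \<in> carrier M \<Longrightarrow> (x \<oplus>\<^bsub>M\<^esub> y) \<ominus>\<^bsub>M\<^esub> y = x"
  by (simp add: a_minus_def M.a_assoc M.r_neg)

lemma add_diff_cancel_left [simp]:
  "x \<in> carrier M \<Longrightarrow> y \<in> carrier M \<Longrightarrow> (x \<oplus>\<^bsub>M\<^esub> y) \<ominus>\<^bsub>M\<^esub> x = y"
  by (simp add: M.a_comm[of x y])

lemma diff_add_cancel [simp]:
  "x \<in> carrier M \<Longrightarrow> y \<in> carrier M \<Longrightarrow> (x \<ominus>\<^bsub>M\<^esub> y) \<oplus>\<^bsub>M\<^esub> y = x"
  by (simp add: a_minus_def M.a_assoc M.l_neg)

lemma add_diff_right_cancel [simp]:
  "x \<in> carrier M \<Longrightarrow> y \<in> carrier M \<Longrightarrow> y \<oplus>\<^bsub>M\<^esub> (x \<ominus>\<^bsub>M\<^esub> y) = x"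
  by (simp add: M.a_comm[of y "x \<ominus>\<^bsub>M\<^esub> y"])

lemma diff_eq_zero_iff:
  "x \<in> carrier M \<Longrightarrow> y \<in> carrier M \<Longrightarrow> x \<ominus>\<^bsub>M\<^esub> y = \<zero>\<^bsub>M\<^esub> \<longleftrightarrow> x = y"
  by (metis diff_add_cancel diff_self M.l_zero)

lemma hom_id: "(\<lambda>x. x) \<in> module_hom R M M"
  unfolding module_hom_def by auto

lemma hom_comp:
  "f \<in> module_hom R M M \<Longrightarrow> g \<in> module_hom R M M \<Longrightarrow> (\<lambda>x. f (g x)) \<in> module_hom R M M"
  by (subst module_hom_def) auto

lemma hom_plus:
  assumes "f \<in> module_hom R M M" "g \<in> module_hom R M M"
  shows "(\<lambda>x. f x \<oplus>\<^bsub>M\<^esub> g x) \<in> module_hom R M M"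
proof -
  have "f (x \<oplus>\<^bsub>M\<^esub> y) \<oplus>\<^bsub>M\<^esub> g (x \<oplus>\<^bsub>M\<^esub> y) = (f x \<oplus>\<^bsub>M\<^esub> g x) \<oplus>\<^bsub>M\<^esub> (f y \<oplus>\<^bsub>M\<^esub> g y)"
    if "x \<in> carrier M" "y \<in> carrier M" for x y
    using that assms by (simp add: M.a_ac)
  then show ?thesis
    using assms by (subst module_hom_def) (auto simp: smult_r_distr)
qed

lemma hom_scale:
  assumes "f \<in> module_hom R M M" "r \<in> carrier R"
  shows "(\<lambda>x. r \<odot>\<^bsub>M\<^esub> f x) \<in> module_hom R M M"
  using assms by (subst module_hom_def) (auto simp: smult_r_distr smult_commute)

lemma hom_diff:
  assumes "f \<in> module_hom R M M" "g \<in> module_hom R M M"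
  shows "(\<lambda>x. f x \<ominus>\<^bsub>M\<^esub> g x) \<in> module_hom R M M"
proof -
  have "(f x \<oplus>\<^bsub>M\<^esub> f y) \<ominus>\<^bsub>M\<^esub> (g x \<oplus>\<^bsub>M\<^esub> g y) = (f x \<ominus>\<^bsub>M\<^esub> g x) \<oplus>\<^bsub>M\<^esub> (f y \<ominus>\<^bsub>M\<^esub> g y)"
    if "x \<in> carrier M" "y \<in> carrier M" for x y
    using that assms by (simp add: a_minus_def M.a_ac M.minus_add)
  then show ?thesis
    using assms by (subst module_hom_def) (auto simp: smult_r_diff)
qed

section \<open>Kernels, images, unions of chains and sums of submodules\<close>

lemma hom_kernel_submodule:
  assumes "f \<in> module_hom R M M"
  shows "submodule {x \<in> carrier M. f x = \<zero>\<^bsub>M\<^esub>} R M"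
  using assms by (intro submoduleI) auto

lemma hom_image_submodule:
  assumes f: "f \<in> module_hom R M M"
  shows "submodule (f ` carrier M) R M"
proof (rule submoduleI)
  show "\<zero>\<^bsub>M\<^esub> \<in> f ` carrier M"
    using f by (intro image_eqI[of _ _ "\<zero>\<^bsub>M\<^esub>"]) auto
  show "\<ominus>\<^bsub>M\<^esub> a \<in> f ` carrier M" if a: "a \<in> f ` carrier M" for a
  proof -
    obtain x where "x \<in> carrier M" "a = f x" using a by blast
    then show ?thesis using f by (intro image_eqI[of _ _ "\<ominus>\<^bsub>M\<^esub> x"]) auto
  qed
  show "a \<oplus>\<^bsub>M\<^esub> b \<in> f ` carrier M" if ab: "a \<in> f ` carrier M" "b \<in> f ` carrier M" for a b
  proof -
    obtain x y where "x \<in> carrier M" "a = f x" "y \<in> carrier M" "b = f y" using ab by blast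
    then show ?thesis using f by (intro image_eqI[of _ _ "x \<oplus>\<^bsub>M\<^esub> y"]) auto
  qed
  show "r \<odot>\<^bsub>M\<^esub> a \<in> f ` carrier M" if ra: "r \<in> carrier R" "a \<in> f ` carrier M" for r a
  proof -
    obtain x where "x \<in> carrier M" "a = f x" using ra by blast
    then show ?thesis using f ra(1) by (intro image_eqI[of _ _ "r \<odot>\<^bsub>M\<^esub> x"]) auto
  qed
qed (use f in auto)

lemma cyclic_submodule:
  assumes x: "x \<in> carrier M"
  shows "submodule ((\<lambda>r. r \<odot>\<^bsub>M\<^esub> x) ` carrier R) R M"
proof (rule submoduleI)
  show "\<zero>\<^bsub>M\<^esub> \<in> (\<lambda>r. r \<odot>\<^bsub>M\<^esub> x) ` carrier R"
    using x by (intro image_eqI[of _ _ "\<zero>"]) auto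
  show "\<ominus>\<^bsub>M\<^esub> a \<in> (\<lambda>r. r \<odot>\<^bsub>M\<^esub> x) ` carrier R" if a: "a \<in> (\<lambda>r. r \<odot>\<^bsub>M\<^esub> x) ` carrier R" for a
  proof -
    obtain r where "r \<in> carrier R" "a = r \<odot>\<^bsub>M\<^esub> x" using a by blast
    then show ?thesis using x by (intro image_eqI[of _ _ "\<ominus> r"]) (auto simp: smult_l_minus)
  qed
  show "a \<oplus>\<^bsub>M\<^esub> b \<in> (\<lambda>r. r \<odot>\<^bsub>M\<^esub> x) ` carrier R"
    if ab: "a \<in> (\<lambda>r. r \<odot>\<^bsub>M\<^esub> x) ` carrier R" "b \<in> (\<lambda>r. r \<odot>\<^bsub>M\<^esub> x) ` carrier R" for a b
  proof -
    obtain r s where "r \<in> carrier R" "a = r \<odot>\<^bsub>M\<^esub> x" "s \<in> carrier R" "b = s \<odot>\<^bsub>M\<^esub> x" using ab by blast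
    then show ?thesis using x by (intro image_eqI[of _ _ "r \<oplus> s"]) (auto simp: smult_l_distr)
  qed
  show "s \<odot>\<^bsub>M\<^esub> a \<in> (\<lambda>r. r \<odot>\<^bsub>M\<^esub> x) ` carrier R"
    if sa: "s \<in> carrier R" "a \<in> (\<lambda>r. r \<odot>\<^bsub>M\<^esub> x) ` carrier R" for s a
  proof -
    obtain r where "r \<in> carrier R" "a = r \<odot>\<^bsub>M\<^esub> x" using sa by blast
    then show ?thesis using x sa by (intro image_eqI[of _ _ "s \<otimes> r"]) (auto simp: smult_assoc1)
  qed
qed (use x in auto)

lemma submodule_diff:
  assumes "submodule N R M" "x \<in> N" "y \<in> N"
  shows "x \<ominus>\<^bsub>M\<^esub> y \<in> N"
  using submoduleE(3,5)[OF assms(1)] assms unfolding a_minus_def by auto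

lemma submodule_zero:
  assumes "submodule N R M"
  shows "\<zero>\<^bsub>M\<^esub> \<in> N"
  using submodule_diff[OF assms] submoduleE(1,2)[OF assms] diff_self by (metis equals0I subsetD)

lemma submodule_Union_chain:
  assumes ch: "subset.chain {N. submodule N R M} C" and ne: "C \<noteq> {}"
  shows "submodule (\<Union>C) R M"
proof -
  have sub: "submodule N R M" if "N \<in> C" for N
    using that ch unfolding subset_chain_def by auto
  have common: "\<exists>N\<in>C. x \<in> N \<and> y \<in> N" if "x \<in> \<Union>C" "y \<in> \<Union>C" for x y
    using that ch unfolding subset_chain_def by blast
  show ?thesis
  proof (rule submoduleI)
    show "\<Union>C \<subseteq> carrier M" using sub submoduleE(1) by blast
    show "\<zero>\<^bsub>M\<^esub> \<in> \<Union>C" using ne sub submodule_zero by blast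
    show "\<ominus>\<^bsub>M\<^esub> a \<in> \<Union>C" if "a \<in> \<Union>C" for a using that sub submoduleE(3) by blast
    show "a \<oplus>\<^bsub>M\<^esub> b \<in> \<Union>C" if "a \<in> \<Union>C" "b \<in> \<Union>C" for a b
      using common[OF that] sub submoduleE(5) by blast
    show "r \<odot>\<^bsub>M\<^esub> a \<in> \<Union>C" if "r \<in> carrier R" "a \<in> \<Union>C" for r a
      using that sub submoduleE(4) by blast
  qed
qed

text \<open>Zorn's lemma, with a lower bound \<open>P\<close> and an upper bound \<open>Q\<close>.
  One instance yields a complement of a submodule, with \<open>Q\<close> the whole module. Another
  yields a maximal essential extension inside a summand, with \<open>Q\<close> the image of a
  projection.\<close>

lemma exists_maximal_disjoint_submodule:
  assumes P: "submodule P R M" "P \<subseteq> Q" "P \<inter> Y \<subseteq> {\<zero>\<^bsub>M\<^esub>}"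
  obtains C where "submodule C R M" "P \<subseteq> C" "C \<subseteq> Q" "C \<inter> Y \<subseteq> {\<zero>\<^bsub>M\<^esub>}"
    "\<And>D. submodule D R M \<Longrightarrow> C \<subseteq> D \<Longrightarrow> D \<subseteq> Q \<Longrightarrow> D \<inter> Y \<subseteq> {\<zero>\<^bsub>M\<^esub>} \<Longrightarrow> D = C"
proof -
  define \<F> where "\<F> = {C. submodule C R M \<and> P \<subseteq> C \<and> C \<subseteq> Q \<and> C \<inter> Y \<subseteq> {\<zero>\<^bsub>M\<^esub>}}"
  have "\<exists>C\<in>\<F>. \<forall>D\<in>\<F>. C \<subseteq> D \<longrightarrow> D = C"
  proof (rule subset_Zorn_nonempty)
    show "\<F> \<noteq> {}" using P unfolding \<F>_def by blast
    fix \<C> assume C: "\<C> \<noteq> {}" "subset.chain \<F> \<C>"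
    then have F: "C \<in> \<F>" if "C \<in> \<C>" for C using that unfolding subset_chain_def by auto
    have "subset.chain {N. submodule N R M} \<C>"
      using C(2) F unfolding subset_chain_def by (auto simp: \<F>_def)
    then have "submodule (\<Union>\<C>) R M" using C(1) by (rule submodule_Union_chain)
    moreover have "P \<subseteq> \<Union>\<C>" "\<Union>\<C> \<subseteq> Q" "\<Union>\<C> \<inter> Y \<subseteq> {\<zero>\<^bsub>M\<^esub>}"
      using C(1) F unfolding \<F>_def by blast+
    ultimately show "\<Union>\<C> \<in> \<F>" unfolding \<F>_def by blast
  qed
  then obtain C where C: "C \<in> \<F>" "\<And>D. D \<in> \<F> \<Longrightarrow> C \<subseteq> D \<Longrightarrow> D = C" by blast
  show thesis
  proof (rule that[of C])
    show "D = C" if "submodule D R M" "C \<subseteq> D" "D \<subseteq> Q" "D \<inter> Y \<subseteq> {\<zero>\<^bsub>M\<^esub>}" for D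
    proof (rule C(2))
      show "D \<in> \<F>" using C(1) that by (auto simp: \<F>_def)
    qed (rule that)
  qed (use C(1) in \<open>auto simp: \<F>_def\<close>)
qed

lemma submodule_sum:
  assumes U: "submodule U R M" and V: "submodule V R M"
  shows "submodule {u \<oplus>\<^bsub>M\<^esub> v | u v. u \<in> U \<and> v \<in> V} R M"
    and "U \<subseteq> {u \<oplus>\<^bsub>M\<^esub> v | u v. u \<in> U \<and> v \<in> V}"
    and "V \<subseteq> {u \<oplus>\<^bsub>M\<^esub> v | u v. u \<in> U \<and> v \<in> V}"
proof -
  let ?S = "{u \<oplus>\<^bsub>M\<^esub> v | u v. u \<in> U \<and> v \<in> V}"
  have c: "\<And>u. u \<in> U \<Longrightarrow> u \<in> carrier M" "\<And>v. v \<in> V \<Longrightarrow> v \<in> carrier M"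
    using submoduleE(1)[OF U] submoduleE(1)[OF V] by auto
  show "U \<subseteq> ?S"
  proof
    fix u assume "u \<in> U"
    then show "u \<in> ?S"
      using submodule_zero[OF V] c by (intro CollectI exI[of _ u] exI[of _ "\<zero>\<^bsub>M\<^esub>"]) auto
  qed
  then have z: "\<zero>\<^bsub>M\<^esub> \<in> ?S" using submodule_zero[OF U] by blast
  show "V \<subseteq> ?S"
  proof
    fix v assume "v \<in> V"
    then show "v \<in> ?S"
      using submodule_zero[OF U] c by (intro CollectI exI[of _ "\<zero>\<^bsub>M\<^esub>"] exI[of _ v]) auto
  qed
  show "submodule ?S R M"
  proof (rule submoduleI[OF _ z])
    show "?S \<subseteq> carrier M" using c by auto
    show "\<ominus>\<^bsub>M\<^esub> a \<in> ?S" if "a \<in> ?S" for a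
    proof -
      from that obtain u v where "u \<in> U" "v \<in> V" "a = u \<oplus>\<^bsub>M\<^esub> v" by blast
      then show ?thesis using c submoduleE(3)[OF U] submoduleE(3)[OF V]
        by (intro CollectI exI[of _ "\<ominus>\<^bsub>M\<^esub> u"] exI[of _ "\<ominus>\<^bsub>M\<^esub> v"]) (simp add: M.minus_add)
    qed
    show "a \<oplus>\<^bsub>M\<^esub> b \<in> ?S" if "a \<in> ?S" "b \<in> ?S" for a b
    proof -
      from that obtain u v u' v' where "u \<in> U" "v \<in> V" "a = u \<oplus>\<^bsub>M\<^esub> v" "u' \<in> U" "v' \<in> V" "b = u' \<oplus>\<^bsub>M\<^esub> v'"
        by blast
      then show ?thesis using c submoduleE(5)[OF U] submoduleE(5)[OF V]
        by (intro CollectI exI[of _ "u \<oplus>\<^bsub>M\<^esub> u'"] exI[of _ "v \<oplus>\<^bsub>M\<^esub> v'"]) (simp add: M.a_ac)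
    qed
    show "r \<odot>\<^bsub>M\<^esub> a \<in> ?S" if "r \<in> carrier R" "a \<in> ?S" for r a
    proof -
      from that obtain u v where "u \<in> U" "v \<in> V" "a = u \<oplus>\<^bsub>M\<^esub> v" by blast
      then show ?thesis using c that submoduleE(4)[OF U] submoduleE(4)[OF V]
        by (intro CollectI exI[of _ "r \<odot>\<^bsub>M\<^esub> u"] exI[of _ "r \<odot>\<^bsub>M\<^esub> v"]) (simp add: smult_r_distr)
    qed
  qed
qed

end

section \<open>Injective modules\<close>

locale injective_mod = module R M for R (structure) and M (structure) +
  assumes injective: "injective_module R M"
begin

text \<open>A partial endomorphism is given by its graph, so that its domain can remain implicit.
  The graph is closed under subtraction; hence it is single-valued as soon as only zero lies over
  zero. Injectivity is then applied to the inclusion of the domain.\<close>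

lemma extend_graph:
  assumes G: "G \<subseteq> carrier M \<times> carrier M" "(\<zero>\<^bsub>M\<^esub>, \<zero>\<^bsub>M\<^esub>) \<in> G"
    and add: "\<And>x u y v. (x, u) \<in> G \<Longrightarrow> (y, v) \<in> G \<Longrightarrow> (x \<oplus>\<^bsub>M\<^esub> y, u \<oplus>\<^bsub>M\<^esub> v) \<in> G"
    and smult: "\<And>r x u. r \<in> carrier R \<Longrightarrow> (x, u) \<in> G \<Longrightarrow> (r \<odot>\<^bsub>M\<^esub> x, r \<odot>\<^bsub>M\<^esub> u) \<in> G"
    and zero: "\<And>u. (\<zero>\<^bsub>M\<^esub>, u) \<in> G \<Longrightarrow> u = \<zero>\<^bsub>M\<^esub>"
  obtains g where "g \<in> module_hom R M M" "\<And>x u. (x, u) \<in> G \<Longrightarrow> g x = u"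
proof -
  have GM: "x \<in> carrier M" "u \<in> carrier M" if "(x, u) \<in> G" for x u using that G(1) by auto
  have neg: "(\<ominus>\<^bsub>M\<^esub> x, \<ominus>\<^bsub>M\<^esub> u) \<in> G" if "(x, u) \<in> G" for x u
    using smult[OF _ that, of "\<ominus> \<one>"] GM[OF that] by (simp add: smult_l_minus)
  have sv: "u = v" if "(x, u) \<in> G" "(x, v) \<in> G" for x u v
    using add[OF that(1) neg[OF that(2)]] GM[OF that(1)] GM[OF that(2)] zero[of "u \<ominus>\<^bsub>M\<^esub> v"]
    by (simp add: M.r_neg diff_eq_zero_iff flip: a_minus_def)
  define h where "h x = (THE u. (x, u) \<in> G)" for x
  have h_eq: "h x = u" if "(x, u) \<in> G" for x u
    unfolding h_def using that sv by (intro the_equality) auto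
  \<comment> \<open>\<open>injective_wrt\<close> quantifies over plain module records, whereas
    \<open>M\<close> may have further fields. \<open>T\<close> is \<open>M\<close> without
    these.\<close>
  define T :: "('a, 'c) module" where
    "T = \<lparr>carrier = carrier M, monoid.mult = monoid.mult M, one = one M, ring.zero = ring.zero M,
          ring.add = ring.add M, smult = smult M\<rparr>"
  have T: "carrier T = carrier M" "ring.zero T = ring.zero M" "ring.add T = ring.add M" "smult T = smult M"
    unfolding T_def by simp_all
  have "abelian_group T"
    by (rule abelian_groupI) (auto simp: T M.a_ac intro: M.l_neg)
  then have TM: "module R T"
    by (intro moduleI) (auto simp: T R.is_cring smult_l_distr smult_r_distr smult_assoc1)
  interpret T: module R T by (rule TM)
  have Tneg: "\<ominus>\<^bsub>T\<^esub> x = \<ominus>\<^bsub>M\<^esub> x" if "x \<in> carrier M" for x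
    using that T.smult_l_minus[of \<one> x] smult_l_minus[of \<one> x] T.smult_one[of x] smult_one[of x] T by simp
  have "submodule (Domain G) R T"
  proof (rule T.submoduleI)
    show "Domain G \<subseteq> carrier T" using GM T by auto
    show "\<zero>\<^bsub>T\<^esub> \<in> Domain G" using G(2) T by auto
    show "\<ominus>\<^bsub>T\<^esub> a \<in> Domain G" if "a \<in> Domain G" for a
      using that neg GM Tneg by (metis Domain_iff)
    show "a \<oplus>\<^bsub>T\<^esub> b \<in> Domain G" if "a \<in> Domain G" "b \<in> Domain G" for a b
      using that add unfolding T Domain_iff by blast
    show "r \<odot>\<^bsub>T\<^esub> a \<in> Domain G" if "r \<in> carrier R" "a \<in> Domain G" for r a
      using that smult unfolding T Domain_iff by blast
  qed
  then have AM: "module R (T\<lparr>carrier := Domain G\<rparr>)"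
    by (rule submodule.submodule_is_module) (rule TM)
  have "(\<lambda>x. x) \<in> module_hom R (T\<lparr>carrier := Domain G\<rparr>) T"
    using GM T unfolding module_hom_def by auto
  moreover have "inj_on (\<lambda>x. x) (carrier (T\<lparr>carrier := Domain G\<rparr>))" by simp
  moreover have "h \<in> module_hom R (T\<lparr>carrier := Domain G\<rparr>) M"
    using GM T h_eq add smult unfolding module_hom_def by auto
  ultimately have "\<exists>g\<in>module_hom R T M. \<forall>x\<in>carrier (T\<lparr>carrier := Domain G\<rparr>). g x = h x"
    using injective_module_imp_injective_wrt[OF injective, where 'c='c] AM TM
    unfolding injective_wrt_def by blast
  then obtain g where "g \<in> module_hom R T M" "\<And>x. x \<in> Domain G \<Longrightarrow> g x = h x" by auto
  moreover have "module_hom R T M = module_hom R M M" unfolding module_hom_def T by simp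
  ultimately show thesis using that h_eq by (metis Domain.DomainI)
qed

text \<open>An injective hull of \<open>U\<close> inside the summand \<open>c M\<close>, given by
  its projection. Let \<open>C\<close> be maximal among the submodules that contain the kernel of
  \<open>c\<close> and miss \<open>U\<close>, and \<open>H\<close> maximal among the submodules of
  \<open>c M\<close> that contain \<open>U\<close> and miss \<open>C\<close>. The projection of the
  direct sum of \<open>H\<close> and \<open>C\<close> onto \<open>H\<close> extends to
  \<open>M\<close>. Maximality of \<open>C\<close> and \<open>H\<close> forces kernel
  \<open>C\<close> and image \<open>H\<close>, and makes \<open>U\<close> essential in
  \<open>H\<close>.\<close>

lemma exists_projection:
  assumes U: "submodule U R M" and c: "c \<in> module_hom R M M"
    and cc: "\<And>y. y \<in> carrier M \<Longrightarrow> c (c y) = c y" and cU: "\<And>u. u \<in> U \<Longrightarrow> c u = u"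
  obtains e where "e \<in> module_hom R M M" "\<And>y. y \<in> carrier M \<Longrightarrow> e (e y) = e y"
    "\<And>u. u \<in> U \<Longrightarrow> e u = u"
    "\<And>y. y \<in> carrier M \<Longrightarrow> c (e y) = e y" "\<And>y. y \<in> carrier M \<Longrightarrow> e (c y) = e y"
    "\<And>y. y \<in> carrier M \<Longrightarrow> e y \<noteq> \<zero>\<^bsub>M\<^esub> \<Longrightarrow> \<exists>r\<in>carrier R. r \<odot>\<^bsub>M\<^esub> e y \<in> U \<and> r \<odot>\<^bsub>M\<^esub> e y \<noteq> \<zero>\<^bsub>M\<^esub>"
proof -
  note UM = submoduleE(1)[OF U]
  have "{y \<in> carrier M. c y = \<zero>\<^bsub>M\<^esub>} \<inter> U \<subseteq> {\<zero>\<^bsub>M\<^esub>}" using cU by auto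
  then obtain C where C: "submodule C R M" "{y \<in> carrier M. c y = \<zero>\<^bsub>M\<^esub>} \<subseteq> C" "C \<subseteq> carrier M"
      "C \<inter> U \<subseteq> {\<zero>\<^bsub>M\<^esub>}"
    and Cmax: "\<And>D. submodule D R M \<Longrightarrow> C \<subseteq> D \<Longrightarrow> D \<subseteq> carrier M \<Longrightarrow> D \<inter> U \<subseteq> {\<zero>\<^bsub>M\<^esub>} \<Longrightarrow> D = C"
    using exists_maximal_disjoint_submodule[OF hom_kernel_submodule[OF c], of "carrier M" U] by auto
  have "U \<subseteq> c ` carrier M" using cU UM by (metis image_eqI subset_iff)
  moreover have "U \<inter> C \<subseteq> {\<zero>\<^bsub>M\<^esub>}" using C(4) by blast
  ultimately obtain H where H: "submodule H R M" "U \<subseteq> H" "H \<subseteq> c ` carrier M" "H \<inter> C \<subseteq> {\<zero>\<^bsub>M\<^esub>}"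
    and Hmax: "\<And>D. submodule D R M \<Longrightarrow> H \<subseteq> D \<Longrightarrow> D \<subseteq> c ` carrier M \<Longrightarrow> D \<inter> C \<subseteq> {\<zero>\<^bsub>M\<^esub>} \<Longrightarrow> D = H"
    using exists_maximal_disjoint_submodule[OF U, of "c ` carrier M" C] by auto
  have HM: "h \<in> carrier M" if "h \<in> H" for h using submoduleE(1)[OF H(1)] that by auto
  have CM: "v \<in> carrier M" if "v \<in> C" for v using C(3) that by auto
  define G where "G = {(h \<oplus>\<^bsub>M\<^esub> v, h) | h v. h \<in> H \<and> v \<in> C}"
  have G: "(h \<oplus>\<^bsub>M\<^esub> v, h) \<in> G" if "h \<in> H" "v \<in> C" for h v using that unfolding G_def by blast
  obtain g where g: "g \<in> module_hom R M M" and gG: "\<And>x u. (x, u) \<in> G \<Longrightarrow> g x = u"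
  proof (rule extend_graph[of G])
    show "G \<subseteq> carrier M \<times> carrier M" unfolding G_def using HM CM by auto
    show "(\<zero>\<^bsub>M\<^esub>, \<zero>\<^bsub>M\<^esub>) \<in> G" using G[OF submodule_zero[OF H(1)] submodule_zero[OF C(1)]] by simp
  next
    fix x u y v assume "(x, u) \<in> G" "(y, v) \<in> G"
    then obtain p q where "u \<in> H" "v \<in> H" "p \<in> C" "q \<in> C" "x = u \<oplus>\<^bsub>M\<^esub> p" "y = v \<oplus>\<^bsub>M\<^esub> q"
      unfolding G_def by blast
    then show "(x \<oplus>\<^bsub>M\<^esub> y, u \<oplus>\<^bsub>M\<^esub> v) \<in> G"
      using G[of "u \<oplus>\<^bsub>M\<^esub> v" "p \<oplus>\<^bsub>M\<^esub> q"] submoduleE(5)[OF H(1)] submoduleE(5)[OF C(1)] HM CM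
      by (simp add: M.a_ac)
  next
    fix r x u assume r: "r \<in> carrier R" and "(x, u) \<in> G"
    then obtain p where "u \<in> H" "p \<in> C" "x = u \<oplus>\<^bsub>M\<^esub> p" unfolding G_def by blast
    then show "(r \<odot>\<^bsub>M\<^esub> x, r \<odot>\<^bsub>M\<^esub> u) \<in> G"
      using r G[of "r \<odot>\<^bsub>M\<^esub> u" "r \<odot>\<^bsub>M\<^esub> p"] submoduleE(4)[OF H(1)] submoduleE(4)[OF C(1)] HM CM
      by (simp add: smult_r_distr)
  next
    fix u assume "(\<zero>\<^bsub>M\<^esub>, u) \<in> G"
    then obtain p where p: "u \<in> H" "p \<in> C" "\<zero>\<^bsub>M\<^esub> = u \<oplus>\<^bsub>M\<^esub> p" unfolding G_def by blast
    then have "u = \<ominus>\<^bsub>M\<^esub> p" using HM CM M.minus_equality by metis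
    then have "u \<in> C" using submoduleE(3)[OF C(1)] p by blast
    then show "u = \<zero>\<^bsub>M\<^esub>" using p H(4) by blast
  qed blast
  \<comment> \<open>Composition with \<open>c\<close> moves the image into \<open>c M\<close> and
    changes nothing on \<open>H\<close>, which \<open>c\<close> fixes pointwise.\<close>
  define e where "e = (\<lambda>y. c (g y))"
  have e: "e \<in> module_hom R M M" unfolding e_def by (rule hom_comp[OF c g])
  have eH: "e h = h" if "h \<in> H" for h
  proof -
    have "g h = h" using gG[OF G[OF that submodule_zero[OF C(1)]]] HM[OF that] by simp
    moreover have "c h = h" using H(3) that cc by auto
    ultimately show ?thesis unfolding e_def by simp
  qed
  have eC: "e v = \<zero>\<^bsub>M\<^esub>" if "v \<in> C" for v
    using gG[OF G[OF submodule_zero[OF H(1)] that]] CM[OF that] c unfolding e_def by simp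
  \<comment> \<open>The kernel contains \<open>C\<close> and still misses \<open>U\<close>, because
    \<open>e\<close> fixes \<open>U\<close>; so it cannot exceed \<open>C\<close>.\<close>
  have "{y \<in> carrier M. e y = \<zero>\<^bsub>M\<^esub>} = C"
  proof (rule Cmax[OF hom_kernel_submodule[OF e]])
    show "{y \<in> carrier M. e y = \<zero>\<^bsub>M\<^esub>} \<inter> U \<subseteq> {\<zero>\<^bsub>M\<^esub>}" using eH H(2) by auto
  qed (use eC CM in auto)
  then have ker: "y \<in> C" if "y \<in> carrier M" "e y = \<zero>\<^bsub>M\<^esub>" for y using that by blast
  have ess: "\<exists>r\<in>carrier R. r \<odot>\<^bsub>M\<^esub> e y \<in> U \<and> r \<odot>\<^bsub>M\<^esub> e y \<noteq> \<zero>\<^bsub>M\<^esub>"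
    if y: "y \<in> carrier M" "e y \<noteq> \<zero>\<^bsub>M\<^esub>" for y
  proof -
    \<comment> \<open>Since \<open>y\<close> lies outside \<open>C\<close>, the sum of
      \<open>C\<close> and \<open>R y\<close> meets \<open>U\<close> in a nonzero element. Its image
      under \<open>e\<close> is itself, and also the multiple of \<open>e y\<close>, as
      \<open>e\<close> kills the summand from \<open>C\<close>.\<close>
    let ?S = "{v \<oplus>\<^bsub>M\<^esub> w | v w. v \<in> C \<and> w \<in> (\<lambda>r. r \<odot>\<^bsub>M\<^esub> y) ` carrier R}"
    note S = submodule_sum[OF C(1) cyclic_submodule[OF y(1)]]
    have "y \<in> (\<lambda>r. r \<odot>\<^bsub>M\<^esub> y) ` carrier R" using y by (intro image_eqI[of _ _ \<one>]) auto
    then have "y \<in> ?S" using S(3) by blast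
    moreover have "y \<notin> C" using y eC by blast
    ultimately have "?S \<noteq> C" by blast
    then have "\<not> ?S \<inter> U \<subseteq> {\<zero>\<^bsub>M\<^esub>}" using Cmax[OF S(1,2) submoduleE(1)[OF S(1)]] by blast
    then obtain v r where u: "v \<in> C" "r \<in> carrier R" "v \<oplus>\<^bsub>M\<^esub> r \<odot>\<^bsub>M\<^esub> y \<in> U" "v \<oplus>\<^bsub>M\<^esub> r \<odot>\<^bsub>M\<^esub> y \<noteq> \<zero>\<^bsub>M\<^esub>"
      by blast
    then have "e (v \<oplus>\<^bsub>M\<^esub> r \<odot>\<^bsub>M\<^esub> y) = v \<oplus>\<^bsub>M\<^esub> r \<odot>\<^bsub>M\<^esub> y" using eH H(2) by blast
    moreover have "e (v \<oplus>\<^bsub>M\<^esub> r \<odot>\<^bsub>M\<^esub> y) = r \<odot>\<^bsub>M\<^esub> e y" using u y e eC CM by simp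
    ultimately show ?thesis using u by metis
  qed
  \<comment> \<open>A nonzero element of the image that lies in \<open>C\<close> would have a
    nonzero multiple in both \<open>U\<close> and \<open>C\<close>. So the image is a competitor of
    \<open>H\<close>.\<close>
  have im: "e ` carrier M = H"
  proof (rule Hmax[OF hom_image_submodule[OF e]])
    show "H \<subseteq> e ` carrier M" using eH HM by (metis image_eqI subsetI)
    show "e ` carrier M \<subseteq> c ` carrier M" unfolding e_def using g by auto
    show "e ` carrier M \<inter> C \<subseteq> {\<zero>\<^bsub>M\<^esub>}"
    proof (rule ccontr)
      assume "\<not> e ` carrier M \<inter> C \<subseteq> {\<zero>\<^bsub>M\<^esub>}"
      then obtain y where y: "y \<in> carrier M" "e y \<in> C" "e y \<noteq> \<zero>\<^bsub>M\<^esub>" by blast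
      then obtain r where "r \<in> carrier R" "r \<odot>\<^bsub>M\<^esub> e y \<in> U" "r \<odot>\<^bsub>M\<^esub> e y \<noteq> \<zero>\<^bsub>M\<^esub>" using ess by blast
      then show False using submoduleE(4)[OF C(1)] y C(4) by blast
    qed
  qed
  show thesis
  proof (rule that[OF e])
    show "e (e y) = e y" if "y \<in> carrier M" for y using im eH that by blast
    show "e u = u" if "u \<in> U" for u using eH H(2) that by blast
    show "c (e y) = e y" if "y \<in> carrier M" for y unfolding e_def using cc that g by simp
    show "e (c y) = e y" if y: "y \<in> carrier M" for y
    proof -
      have "y \<ominus>\<^bsub>M\<^esub> c y \<in> C" using C(2) y c cc by auto
      then have "e (y \<ominus>\<^bsub>M\<^esub> c y) = \<zero>\<^bsub>M\<^esub>" by (rule eC)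
      then show ?thesis using y e c by (simp add: diff_eq_zero_iff)
    qed
  qed (use ess in blast)
qed

end

section \<open>Annihilators\<close>

context module
begin

section \<open>Annihilators of elements and associated primes\<close>

definition ann :: "'c \<Rightarrow> 'a set"
  where "ann x = {r \<in> carrier R. r \<odot>\<^bsub>M\<^esub> x = \<zero>\<^bsub>M\<^esub>}"

text \<open>These are the generators of the submodules isomorphic to \<open>R/p\<close> with
  \<open>p\<close> an associated prime. The condition that \<open>x\<close> is nonzero makes the
  prime ideal proper.\<close>

definition prime_ann :: "'c \<Rightarrow> bool"
  where "prime_ann x \<longleftrightarrow> x \<in> carrier M \<and> x \<noteq> \<zero>\<^bsub>M\<^esub> \<and>
    (\<forall>a\<in>carrier R. \<forall>b\<in>carrier R. (a \<otimes> b) \<odot>\<^bsub>M\<^esub> x = \<zero>\<^bsub>M\<^esub> \<longrightarrow>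
      a \<odot>\<^bsub>M\<^esub> x = \<zero>\<^bsub>M\<^esub> \<or> b \<odot>\<^bsub>M\<^esub> x = \<zero>\<^bsub>M\<^esub>)"

lemma prime_ann_nonzero:
  assumes "prime_ann x" "a \<in> carrier R" "b \<in> carrier R"
    "a \<odot>\<^bsub>M\<^esub> x \<noteq> \<zero>\<^bsub>M\<^esub>" "b \<odot>\<^bsub>M\<^esub> x \<noteq> \<zero>\<^bsub>M\<^esub>"
  shows "a \<odot>\<^bsub>M\<^esub> (b \<odot>\<^bsub>M\<^esub> x) \<noteq> \<zero>\<^bsub>M\<^esub>"
proof -
  have "x \<in> carrier M" and "(a \<otimes> b) \<odot>\<^bsub>M\<^esub> x \<noteq> \<zero>\<^bsub>M\<^esub>"
    using assms unfolding prime_ann_def by blast+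
  then show ?thesis using assms(2,3) by (simp add: smult_assoc1)
qed

lemma ann_ideal:
  assumes x: "x \<in> carrier M"
  shows "ideal (ann x) R"
proof (rule idealI[OF R.ring_axioms])
  show "subgroup (ann x) (add_monoid R)"
  proof (rule subgroup.intro)
    show "inv\<^bsub>add_monoid R\<^esub> r \<in> ann x" if "r \<in> ann x" for r
    proof -
      have "\<ominus> r \<in> ann x" using that x unfolding ann_def by (auto simp: smult_l_minus)
      then show ?thesis unfolding a_inv_def .
    qed
  qed (use x in \<open>auto simp: ann_def smult_l_distr\<close>)
  show "s \<otimes> r \<in> ann x" "r \<otimes> s \<in> ann x" if "r \<in> ann x" "s \<in> carrier R" for r s
    using that x smult_commute[of r s x] unfolding ann_def by (auto simp: smult_assoc1)
qed

text \<open>The union of a nonempty chain of ideals of a noetherian ring is a member of the chain,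
  so Zorn's lemma applies to every nonempty set of annihilators.\<close>

lemma exists_maximal_ann:
  assumes noeth: "noetherian_ring R" and S: "S \<subseteq> carrier M" "S \<noteq> {}"
  obtains x where "x \<in> S" "\<And>y. y \<in> S \<Longrightarrow> ann x \<subseteq> ann y \<Longrightarrow> ann y = ann x"
proof -
  have "\<exists>I\<in>ann ` S. \<forall>J\<in>ann ` S. I \<subseteq> J \<longrightarrow> J = I"
  proof (rule subset_Zorn_nonempty)
    fix C assume C: "C \<noteq> {}" "subset.chain (ann ` S) C"
    then have "subset.chain {I. ideal I R} C"
      using ann_ideal S(1) unfolding subset_chain_def by blast
    with C have "\<Union>C \<in> C" by (intro noetherian_ring.ideal_chain_is_trivial[OF noeth])
    then show "\<Union>C \<in> ann ` S" using C(2) unfolding subset_chain_def by blast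
  qed (use S in auto)
  then show thesis using that by blast
qed

text \<open>Noetherian induction: a counterexample with maximal annihilator contradicts the
  step.\<close>

lemma ann_induct [consumes 2, case_names less]:
  assumes noeth: "noetherian_ring R" and x: "x \<in> carrier M"
    and step: "\<And>x. x \<in> carrier M \<Longrightarrow> (\<And>y. y \<in> carrier M \<Longrightarrow> ann x \<subset> ann y \<Longrightarrow> P y) \<Longrightarrow> P x"
  shows "P x"
proof (rule ccontr)
  assume "\<not> P x"
  with x have "{x \<in> carrier M. \<not> P x} \<noteq> {}" by blast
  then obtain z where z: "z \<in> {x \<in> carrier M. \<not> P x}"
    and max: "\<And>y. y \<in> {x \<in> carrier M. \<not> P x} \<Longrightarrow> ann z \<subseteq> ann y \<Longrightarrow> ann y = ann z"
    using exists_maximal_ann[OF noeth, of "{x \<in> carrier M. \<not> P x}"] by auto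
  have "P z" by (rule step) (use z max in auto)
  with z show False by blast
qed

text \<open>Choose \<open>x\<close> with maximal annihilator among the nonzero multiples of
  \<open>y\<close>. If \<open>b x\<close> is nonzero, it is such a multiple too and its annihilator
  contains that of \<open>x\<close>, so the two agree. Hence \<open>a b x = 0\<close> gives
  \<open>a x = 0\<close>.\<close>

lemma exists_prime_multiple:
  assumes noeth: "noetherian_ring R" and y: "y \<in> carrier M" "y \<noteq> \<zero>\<^bsub>M\<^esub>"
  obtains s where "s \<in> carrier R" "prime_ann (s \<odot>\<^bsub>M\<^esub> y)"
proof -
  let ?S = "{s \<odot>\<^bsub>M\<^esub> y | s. s \<in> carrier R \<and> s \<odot>\<^bsub>M\<^esub> y \<noteq> \<zero>\<^bsub>M\<^esub>}"
  have "y \<in> ?S" using y by (intro CollectI exI[of _ \<one>]) auto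
  then have "?S \<noteq> {}" "?S \<subseteq> carrier M" using y by auto
  then obtain x where x: "x \<in> ?S" and max: "\<And>z. z \<in> ?S \<Longrightarrow> ann x \<subseteq> ann z \<Longrightarrow> ann z = ann x"
    using exists_maximal_ann[OF noeth, of ?S] by auto
  from x obtain s where s: "s \<in> carrier R" "x = s \<odot>\<^bsub>M\<^esub> y" "x \<noteq> \<zero>\<^bsub>M\<^esub>" by blast
  then have xM: "x \<in> carrier M" using y by simp
  have "prime_ann x"
    unfolding prime_ann_def
  proof (intro conjI ballI impI)
    fix a b assume ab: "a \<in> carrier R" "b \<in> carrier R" "(a \<otimes> b) \<odot>\<^bsub>M\<^esub> x = \<zero>\<^bsub>M\<^esub>"
    show "a \<odot>\<^bsub>M\<^esub> x = \<zero>\<^bsub>M\<^esub> \<or> b \<odot>\<^bsub>M\<^esub> x = \<zero>\<^bsub>M\<^esub>"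
    proof (rule disjCI)
      assume b: "b \<odot>\<^bsub>M\<^esub> x \<noteq> \<zero>\<^bsub>M\<^esub>"
      have "b \<odot>\<^bsub>M\<^esub> x \<in> ?S"
        using b s ab y by (intro CollectI exI[of _ "b \<otimes> s"]) (auto simp: smult_assoc1)
      moreover have "ann x \<subseteq> ann (b \<odot>\<^bsub>M\<^esub> x)"
        using ab(2) xM unfolding ann_def by (auto simp: smult_commute[of _ b])
      ultimately have "ann (b \<odot>\<^bsub>M\<^esub> x) = ann x" by (rule max)
      moreover have "a \<in> ann (b \<odot>\<^bsub>M\<^esub> x)" using ab xM unfolding ann_def by (simp add: smult_assoc1)
      ultimately show "a \<odot>\<^bsub>M\<^esub> x = \<zero>\<^bsub>M\<^esub>" unfolding ann_def by blast
    qed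
  qed (use s xM in auto)
  then show thesis using that s by blast
qed

text \<open>This makes the noetherian inductions progress. By linearity \<open>1 - f\<close>
  preserves annihilation, and \<open>s\<close> is a new annihilator because \<open>1 - f\<close>
  kills \<open>s y\<close>.\<close>

lemma ann_psubset_diff:
  assumes f: "f \<in> module_hom R M M" and y: "y \<in> carrier M" and s: "s \<in> carrier R"
    and sy: "s \<odot>\<^bsub>M\<^esub> y \<noteq> \<zero>\<^bsub>M\<^esub>" "f (s \<odot>\<^bsub>M\<^esub> y) = s \<odot>\<^bsub>M\<^esub> y"
  shows "ann y \<subset> ann (y \<ominus>\<^bsub>M\<^esub> f y)"
proof
  have "r \<odot>\<^bsub>M\<^esub> f y = f (r \<odot>\<^bsub>M\<^esub> y)" if "r \<in> carrier R" for r using that f y by simp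
  then show "ann y \<subseteq> ann (y \<ominus>\<^bsub>M\<^esub> f y)"
    using y f unfolding ann_def by (auto simp: smult_r_diff simp del: hom_smult)
  have "s \<odot>\<^bsub>M\<^esub> f y = s \<odot>\<^bsub>M\<^esub> y" using sy(2) f y s by simp
  then have "s \<in> ann (y \<ominus>\<^bsub>M\<^esub> f y)" using y f s unfolding ann_def by (simp add: smult_r_diff)
  moreover have "s \<notin> ann y" using sy(1) unfolding ann_def by simp
  ultimately show "ann y \<noteq> ann (y \<ominus>\<^bsub>M\<^esub> f y)" by blast
qed

end

section \<open>Projections onto indecomposable injective modules\<close>

context injective_mod
begin

text \<open>\<open>e\<close> is a projection onto an injective hull of \<open>R x\<close>; this hull is uniform, since \<open>Ann x\<close> is prime.\<close>

definition hull_proj :: "('c \<Rightarrow> 'c) \<Rightarrow> 'c \<Rightarrow> bool"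
  where "hull_proj e x \<longleftrightarrow> prime_ann x \<and> e \<in> module_hom R M M \<and>
    (\<forall>y\<in>carrier M. e (e y) = e y) \<and> e x = x \<and>
    (\<forall>y\<in>carrier M. e y \<noteq> \<zero>\<^bsub>M\<^esub> \<longrightarrow>
      (\<exists>r\<in>carrier R. \<exists>s\<in>carrier R. r \<odot>\<^bsub>M\<^esub> e y = s \<odot>\<^bsub>M\<^esub> x \<and> s \<odot>\<^bsub>M\<^esub> x \<noteq> \<zero>\<^bsub>M\<^esub>))"

lemma hull_projD:
  assumes "hull_proj e x"
  shows "prime_ann x" "x \<in> carrier M" "x \<noteq> \<zero>\<^bsub>M\<^esub>" "e \<in> module_hom R M M"
    "\<And>y. y \<in> carrier M \<Longrightarrow> e (e y) = e y" "e x = x"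
  using assms unfolding hull_proj_def prime_ann_def by auto

lemma hull_proj_essential:
  assumes "hull_proj e x" "y \<in> carrier M" "e y \<noteq> \<zero>\<^bsub>M\<^esub>"
  obtains r s where "r \<in> carrier R" "s \<in> carrier R" "r \<odot>\<^bsub>M\<^esub> e y = s \<odot>\<^bsub>M\<^esub> x" "s \<odot>\<^bsub>M\<^esub> x \<noteq> \<zero>\<^bsub>M\<^esub>"
  using assms unfolding hull_proj_def by blast

text \<open>The projection \<open>c\<close> prescribes a summand in which the hull is to lie. It is
  the identity where no restriction is wanted, and \<open>1 - e\<close> where the hull has to lie in
  the complement of an earlier one.\<close>

lemma exists_hull_proj:
  assumes x: "prime_ann x" and c: "c \<in> module_hom R M M"
    and cc: "\<And>y. y \<in> carrier M \<Longrightarrow> c (c y) = c y" and cx: "c x = x"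
  obtains e where "hull_proj e x"
    "\<And>y. y \<in> carrier M \<Longrightarrow> c (e y) = e y" "\<And>y. y \<in> carrier M \<Longrightarrow> e (c y) = e y"
proof -
  have xM: "x \<in> carrier M" using x unfolding prime_ann_def by blast
  have cu: "c u = u" if "u \<in> (\<lambda>r. r \<odot>\<^bsub>M\<^esub> x) ` carrier R" for u using that c cx xM by auto
  obtain e where e: "e \<in> module_hom R M M" "\<And>y. y \<in> carrier M \<Longrightarrow> e (e y) = e y"
    "\<And>u. u \<in> (\<lambda>r. r \<odot>\<^bsub>M\<^esub> x) ` carrier R \<Longrightarrow> e u = u"
    "\<And>y. y \<in> carrier M \<Longrightarrow> c (e y) = e y" "\<And>y. y \<in> carrier M \<Longrightarrow> e (c y) = e y"
    "\<And>y. y \<in> carrier M \<Longrightarrow> e y \<noteq> \<zero>\<^bsub>M\<^esub> \<Longrightarrow>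
      \<exists>r\<in>carrier R. r \<odot>\<^bsub>M\<^esub> e y \<in> (\<lambda>r. r \<odot>\<^bsub>M\<^esub> x) ` carrier R \<and> r \<odot>\<^bsub>M\<^esub> e y \<noteq> \<zero>\<^bsub>M\<^esub>"
    by (rule exists_projection[OF cyclic_submodule[OF xM] c cc cu]) (assumption | blast)+
  have "x \<in> (\<lambda>r. r \<odot>\<^bsub>M\<^esub> x) ` carrier R" using xM by (intro image_eqI[of _ _ \<one>]) auto
  then have "e x = x" by (rule e(3))
  moreover have "\<exists>r\<in>carrier R. \<exists>s\<in>carrier R. r \<odot>\<^bsub>M\<^esub> e y = s \<odot>\<^bsub>M\<^esub> x \<and> s \<odot>\<^bsub>M\<^esub> x \<noteq> \<zero>\<^bsub>M\<^esub>"
    if "y \<in> carrier M" "e y \<noteq> \<zero>\<^bsub>M\<^esub>" for y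
    using e(6)[OF that] by (metis imageE)
  ultimately have "hull_proj e x" using x e(1,2) unfolding hull_proj_def by blast
  then show thesis using e(4,5) by (rule that)
qed

text \<open>The inclusion of annihilators makes \<open>r x\<close> to \<open>r y\<close> well
  defined on \<open>R x\<close>; injectivity extends it.\<close>

lemma extend_cyclic:
  assumes x: "x \<in> carrier M" and y: "y \<in> carrier M" and ann: "ann x \<subseteq> ann y"
  obtains f where "f \<in> module_hom R M M" "f x = y"
proof -
  define G where "G = {(r \<odot>\<^bsub>M\<^esub> x, r \<odot>\<^bsub>M\<^esub> y) | r. r \<in> carrier R}"
  have G: "(r \<odot>\<^bsub>M\<^esub> x, r \<odot>\<^bsub>M\<^esub> y) \<in> G" if "r \<in> carrier R" for r using that unfolding G_def by blast
  obtain g where g: "g \<in> module_hom R M M" and gG: "\<And>a b. (a, b) \<in> G \<Longrightarrow> g a = b"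
  proof (rule extend_graph[of G])
    show "G \<subseteq> carrier M \<times> carrier M" unfolding G_def using x y by auto
    show "(\<zero>\<^bsub>M\<^esub>, \<zero>\<^bsub>M\<^esub>) \<in> G" using G[OF R.zero_closed] x y by simp
  next
    fix a b a' b' assume "(a, b) \<in> G" "(a', b') \<in> G"
    then obtain r s where "r \<in> carrier R" "s \<in> carrier R" "a = r \<odot>\<^bsub>M\<^esub> x" "b = r \<odot>\<^bsub>M\<^esub> y"
      "a' = s \<odot>\<^bsub>M\<^esub> x" "b' = s \<odot>\<^bsub>M\<^esub> y" unfolding G_def by blast
    then show "(a \<oplus>\<^bsub>M\<^esub> a', b \<oplus>\<^bsub>M\<^esub> b') \<in> G" using G[of "r \<oplus> s"] x y by (simp add: smult_l_distr)
  next
    fix s a b assume s: "s \<in> carrier R" and "(a, b) \<in> G"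
    then obtain r where "r \<in> carrier R" "a = r \<odot>\<^bsub>M\<^esub> x" "b = r \<odot>\<^bsub>M\<^esub> y" unfolding G_def by blast
    then show "(s \<odot>\<^bsub>M\<^esub> a, s \<odot>\<^bsub>M\<^esub> b) \<in> G" using s G[of "s \<otimes> r"] x y by (simp add: smult_assoc1)
  next
    fix b assume "(\<zero>\<^bsub>M\<^esub>, b) \<in> G"
    then obtain r where "r \<in> carrier R" "\<zero>\<^bsub>M\<^esub> = r \<odot>\<^bsub>M\<^esub> x" "b = r \<odot>\<^bsub>M\<^esub> y" unfolding G_def by blast
    then show "b = \<zero>\<^bsub>M\<^esub>" using ann unfolding ann_def by auto
  qed blast
  have "g x = y" using gG[OF G[OF R.one_closed]] x y by simp
  with g show thesis by (rule that)
qed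

text \<open>\<open>R x\<close> is essential in \<open>e M\<close>, so injectivity on
  \<open>e M\<close> can be tested on \<open>R x\<close>; there it is the hypothesis
  \<open>fx\<close>.\<close>

lemma hull_proj_inj:
  assumes e: "hull_proj e x" and f: "f \<in> module_hom R M M"
    and fx: "\<And>s. s \<in> carrier R \<Longrightarrow> s \<odot>\<^bsub>M\<^esub> x \<noteq> \<zero>\<^bsub>M\<^esub> \<Longrightarrow> s \<odot>\<^bsub>M\<^esub> f x \<noteq> \<zero>\<^bsub>M\<^esub>"
    and y: "y \<in> carrier M" "f (e y) = \<zero>\<^bsub>M\<^esub>"
  shows "e y = \<zero>\<^bsub>M\<^esub>"
proof (rule ccontr)
  note D = hull_projD[OF e]
  assume "e y \<noteq> \<zero>\<^bsub>M\<^esub>"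
  then obtain r s where rs: "r \<in> carrier R" "s \<in> carrier R" "r \<odot>\<^bsub>M\<^esub> e y = s \<odot>\<^bsub>M\<^esub> x" "s \<odot>\<^bsub>M\<^esub> x \<noteq> \<zero>\<^bsub>M\<^esub>"
    using hull_proj_essential[OF e y(1)] by blast
  have "f (s \<odot>\<^bsub>M\<^esub> x) = f (r \<odot>\<^bsub>M\<^esub> e y)" by (simp only: rs(3))
  also have "\<dots> = r \<odot>\<^bsub>M\<^esub> f (e y)" using D(4) y(1) by (intro hom_smult f rs(1)) simp
  also have "\<dots> = \<zero>\<^bsub>M\<^esub>" using y(2) rs(1) by simp
  finally have "s \<odot>\<^bsub>M\<^esub> f x = \<zero>\<^bsub>M\<^esub>" using f rs(2) D(2) by simp
  then show False using fx rs by blast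
qed

text \<open>By primeness, a scalar outside \<open>Ann x\<close> acts injectively on
  \<open>R x\<close>, and thus on \<open>e M\<close>.\<close>

lemma hull_proj_scalar_inj:
  assumes e: "hull_proj e x" and r: "r \<in> carrier R" "r \<odot>\<^bsub>M\<^esub> x \<noteq> \<zero>\<^bsub>M\<^esub>"
    and y: "y \<in> carrier M" "r \<odot>\<^bsub>M\<^esub> e y = \<zero>\<^bsub>M\<^esub>"
  shows "e y = \<zero>\<^bsub>M\<^esub>"
proof (rule hull_proj_inj[where f = "\<lambda>z. r \<odot>\<^bsub>M\<^esub> z", OF e _ _ y(1)])
  show "r \<odot>\<^bsub>M\<^esub> e y = \<zero>\<^bsub>M\<^esub>" by (rule y(2))
  show "(\<lambda>z. r \<odot>\<^bsub>M\<^esub> z) \<in> module_hom R M M" by (rule hom_scale[OF hom_id r(1)])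
  show "s \<odot>\<^bsub>M\<^esub> (r \<odot>\<^bsub>M\<^esub> x) \<noteq> \<zero>\<^bsub>M\<^esub>" if "s \<in> carrier R" "s \<odot>\<^bsub>M\<^esub> x \<noteq> \<zero>\<^bsub>M\<^esub>" for s
    using prime_ann_nonzero[OF hull_projD(1)[OF e] that(1) r(1) that(2) r(2)] .
qed

text \<open>A left inverse of \<open>h\<close> on the uniform module \<open>e M\<close> is injective, because its kernel
  misses the image of \<open>h\<close>.\<close>

lemma hull_proj_surj:
  assumes e: "hull_proj e x" and h: "h \<in> module_hom R M M"
    and eh: "\<And>y. y \<in> carrier M \<Longrightarrow> e (h (e y)) = h (e y)"
    and inj: "\<And>y. y \<in> carrier M \<Longrightarrow> h (e y) = \<zero>\<^bsub>M\<^esub> \<Longrightarrow> e y = \<zero>\<^bsub>M\<^esub>"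
    and z: "z \<in> carrier M"
  obtains w where "w \<in> carrier M" "h (e w) = e z"
proof -
  note D = hull_projD[OF e]
  \<comment> \<open>The graph of the inverse of \<open>h\<close>, defined on the image of
    \<open>e M\<close>.\<close>
  define G where "G = {(h (e y), e y) | y. y \<in> carrier M}"
  have G: "(h (e y), e y) \<in> G" if "y \<in> carrier M" for y
    unfolding G_def using that by (intro CollectI exI[of _ y]) simp
  obtain g where g: "g \<in> module_hom R M M" and gG: "\<And>a b. (a, b) \<in> G \<Longrightarrow> g a = b"
  proof (rule extend_graph[of G])
    show "G \<subseteq> carrier M \<times> carrier M" unfolding G_def using h D(4) by auto
    show "(\<zero>\<^bsub>M\<^esub>, \<zero>\<^bsub>M\<^esub>) \<in> G" using G[OF M.zero_closed] h D(4) by simp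
  next
    fix a b a' b' assume "(a, b) \<in> G" "(a', b') \<in> G"
    then obtain p q where "p \<in> carrier M" "q \<in> carrier M" "a = h (e p)" "b = e p" "a' = h (e q)" "b' = e q"
      unfolding G_def by blast
    then show "(a \<oplus>\<^bsub>M\<^esub> a', b \<oplus>\<^bsub>M\<^esub> b') \<in> G" using G[of "p \<oplus>\<^bsub>M\<^esub> q"] h D(4) by simp
  next
    fix s a b assume s: "s \<in> carrier R" and "(a, b) \<in> G"
    then obtain p where "p \<in> carrier M" "a = h (e p)" "b = e p" unfolding G_def by blast
    then show "(s \<odot>\<^bsub>M\<^esub> a, s \<odot>\<^bsub>M\<^esub> b) \<in> G" using s G[of "s \<odot>\<^bsub>M\<^esub> p"] h D(4) by simp
  next
    fix b assume "(\<zero>\<^bsub>M\<^esub>, b) \<in> G"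
    then show "b = \<zero>\<^bsub>M\<^esub>" using inj unfolding G_def by auto
  qed blast
  define k where "k = (\<lambda>y. e (g y))"
  have k: "k \<in> module_hom R M M" unfolding k_def by (rule hom_comp[OF D(4) g])
  have kh: "k (h (e y)) = e y" if "y \<in> carrier M" for y
    using gG[OF G[OF that]] D(5) that unfolding k_def by simp
  have k_inj: "e y = \<zero>\<^bsub>M\<^esub>" if y: "y \<in> carrier M" "k (e y) = \<zero>\<^bsub>M\<^esub>" for y
  proof (rule hull_proj_inj[OF e k _ y])
    \<comment> \<open>The nonzero element \<open>h x\<close> of \<open>e M\<close> shares a nonzero
      multiple with \<open>x\<close>. Applying \<open>k\<close> to it gives
      \<open>s' k x = r' x\<close> with \<open>r' x\<close> nonzero. If \<open>s\<close> killed
      \<open>k x\<close>, it would kill \<open>r' x\<close>, and primeness would force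
      \<open>s x = 0\<close>.\<close>
    have "h x \<noteq> \<zero>\<^bsub>M\<^esub>" using inj[OF D(2)] D(3,6) by auto
    then obtain r' s' where r': "r' \<in> carrier R" "s' \<in> carrier R"
        "r' \<odot>\<^bsub>M\<^esub> h x = s' \<odot>\<^bsub>M\<^esub> x" "s' \<odot>\<^bsub>M\<^esub> x \<noteq> \<zero>\<^bsub>M\<^esub>"
      using hull_proj_essential[OF e, of "h x"] eh[OF D(2)] h D(2,6) by auto
    have "s' \<odot>\<^bsub>M\<^esub> k x = k (s' \<odot>\<^bsub>M\<^esub> x)" using k r'(2) D(2) by simp
    also have "\<dots> = k (r' \<odot>\<^bsub>M\<^esub> h x)" by (simp only: r'(3))
    also have "\<dots> = r' \<odot>\<^bsub>M\<^esub> x" using k r'(1) h D(2,6) kh[OF D(2)] by simp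
    finally have kx: "s' \<odot>\<^bsub>M\<^esub> k x = r' \<odot>\<^bsub>M\<^esub> x" .
    have r'x: "r' \<odot>\<^bsub>M\<^esub> x \<noteq> \<zero>\<^bsub>M\<^esub>"
    proof
      assume "r' \<odot>\<^bsub>M\<^esub> x = \<zero>\<^bsub>M\<^esub>"
      then have "h (r' \<odot>\<^bsub>M\<^esub> x) = \<zero>\<^bsub>M\<^esub>" using h by simp
      then show False using r' h D(2) by simp
    qed
    show "s \<odot>\<^bsub>M\<^esub> k x \<noteq> \<zero>\<^bsub>M\<^esub>" if s: "s \<in> carrier R" "s \<odot>\<^bsub>M\<^esub> x \<noteq> \<zero>\<^bsub>M\<^esub>" for s
    proof
      assume "s \<odot>\<^bsub>M\<^esub> k x = \<zero>\<^bsub>M\<^esub>"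
      then have "s \<odot>\<^bsub>M\<^esub> (s' \<odot>\<^bsub>M\<^esub> k x) = \<zero>\<^bsub>M\<^esub>"
        using smult_commute[of s s' "k x"] s r' k D(2) by simp
      then show False using kx prime_ann_nonzero[OF D(1) s(1) r'(1) s(2) r'x] by simp
    qed
  qed
  \<comment> \<open>The only possible preimage: \<open>k\<close> maps both \<open>e z\<close> and
    \<open>h w\<close> to \<open>w\<close>, and \<open>k\<close> is injective on
    \<open>e M\<close>.\<close>
  define w where "w = k (e z)"
  have w: "w \<in> carrier M" "e w = w" using k D(4,5) z g unfolding w_def k_def by auto
  have "k (e z \<ominus>\<^bsub>M\<^esub> h w) = \<zero>\<^bsub>M\<^esub>" using kh[OF w(1)] w k h D(4) z unfolding w_def[symmetric] by (simp flip: w_def)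
  then have "e (e z \<ominus>\<^bsub>M\<^esub> h w) = \<zero>\<^bsub>M\<^esub>"
    using k_inj[of "e z \<ominus>\<^bsub>M\<^esub> h w"] eh[OF w(1)] w h D(4,5) z by simp
  then have "e z = h w" using eh[OF w(1)] w h D(4,5) z by (simp add: diff_eq_zero_iff)
  then show thesis using that[OF w(1)] w(2) by simp
qed

text \<open>The map is block-diagonal, with \<open>h\<close> on \<open>e M\<close> and the identity
  on \<open>(1 - e) M\<close>. On the uniform injective module \<open>e M\<close> injectivity
  already implies bijectivity, by \<open>hull_proj_surj\<close>.\<close>

lemma hull_proj_aut:
  assumes e: "hull_proj e x" and h: "h \<in> module_hom R M M"
    and eh: "\<And>y. y \<in> carrier M \<Longrightarrow> e (h (e y)) = h (e y)"
    and inj: "\<And>y. y \<in> carrier M \<Longrightarrow> h (e y) = \<zero>\<^bsub>M\<^esub> \<Longrightarrow> e y = \<zero>\<^bsub>M\<^esub>"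
  shows "(\<lambda>y. h (e y) \<oplus>\<^bsub>M\<^esub> (y \<ominus>\<^bsub>M\<^esub> e y)) \<in> module_aut R M"
proof -
  note D = hull_projD[OF e]
  let ?v = "\<lambda>y. h (e y) \<oplus>\<^bsub>M\<^esub> (y \<ominus>\<^bsub>M\<^esub> e y)"
  have v: "?v \<in> module_hom R M M"
    by (rule hom_plus[OF hom_comp[OF h D(4)] hom_diff[OF hom_id D(4)]])
  have ker: "y = \<zero>\<^bsub>M\<^esub>" if y: "y \<in> carrier M" "?v y = \<zero>\<^bsub>M\<^esub>" for y
  proof -
    have "e (?v y) = h (e y)" using y(1) D(4,5) h eh by simp
    then have "e y = \<zero>\<^bsub>M\<^esub>" using inj y D(4) by simp
    then show ?thesis using y h by simp
  qed
  have "y = z" if yz: "y \<in> carrier M" "z \<in> carrier M" "?v y = ?v z" for y z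
  proof -
    have "?v (y \<ominus>\<^bsub>M\<^esub> z) = ?v z \<ominus>\<^bsub>M\<^esub> ?v z"
      using hom_minus[OF v yz(1,2)] yz(3) by (simp only:)
    also have "\<dots> = \<zero>\<^bsub>M\<^esub>" by (rule diff_self[OF hom_closed[OF v yz(2)]])
    finally have "y \<ominus>\<^bsub>M\<^esub> z = \<zero>\<^bsub>M\<^esub>" by (rule ker[OF M.minus_closed[OF yz(1,2)]])
    then show ?thesis using yz by (simp add: diff_eq_zero_iff)
  qed
  then have "inj_on ?v (carrier M)" by (intro inj_onI)
  moreover have "?v ` carrier M = carrier M"
  proof
    show "?v ` carrier M \<subseteq> carrier M" using hom_closed[OF v] by (rule image_subsetI)
    show "carrier M \<subseteq> ?v ` carrier M"
    proof
      fix z assume z: "z \<in> carrier M"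
      obtain w where w: "w \<in> carrier M" "h (e w) = e z" using hull_proj_surj[OF e h eh inj z] by blast
      let ?y = "e w \<oplus>\<^bsub>M\<^esub> (z \<ominus>\<^bsub>M\<^esub> e z)"
      have "e ?y = e w" using w(1) z D(4,5) by simp
      then have "?v ?y = h (e w) \<oplus>\<^bsub>M\<^esub> (?y \<ominus>\<^bsub>M\<^esub> e w)" by (simp only:)
      also have "\<dots> = z" using w z D(4) by simp
      finally have "z = ?v ?y" by (rule sym)
      moreover have "?y \<in> carrier M" using w z D(4) by simp
      ultimately show "z \<in> ?v ` carrier M" by (rule image_eqI)
    qed
  qed
  ultimately show ?thesis using v unfolding module_aut_def bij_betw_def by blast
qed

end

section \<open>Submodules invariant under automorphisms\<close>

locale aut_invariant = injective_mod +
  fixes N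
  assumes N: "submodule N R M"
    and aut: "\<And>f x. f \<in> module_aut R M \<Longrightarrow> x \<in> N \<Longrightarrow> f x \<in> N"
begin

section \<open>Endomorphisms that preserve the invariant submodule \<open>N\<close>\<close>

lemma in_carrier [simp]: "x \<in> N \<Longrightarrow> x \<in> carrier M"
  using submoduleE(1)[OF N] by auto

lemma diff_closed: "x \<in> N \<Longrightarrow> y \<in> N \<Longrightarrow> x \<ominus>\<^bsub>M\<^esub> y \<in> N"
  by (rule submodule_diff[OF N])

lemma add_closed: "x \<in> N \<Longrightarrow> y \<in> N \<Longrightarrow> x \<oplus>\<^bsub>M\<^esub> y \<in> N"
  by (rule submoduleE(5)[OF N])

text \<open>The inverse of an automorphism is an automorphism and preserves \<open>N\<close> as
  well.\<close>

lemma aut_reflects: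
  assumes v: "v \<in> module_aut R M" and y: "y \<in> carrier M" "v y \<in> N"
  shows "y \<in> N"
proof -
  let ?w = "inv_into (carrier M) v"
  have vh: "v \<in> module_hom R M M" and bij: "bij_betw v (carrier M) (carrier M)"
    using v unfolding module_aut_def by auto
  have wbij: "bij_betw ?w (carrier M) (carrier M)" by (rule bij_betw_inv_into[OF bij])
  have wc: "?w z \<in> carrier M" if "z \<in> carrier M" for z using bij_betwE[OF wbij] that by blast
  have vw: "v (?w z) = z" if "z \<in> carrier M" for z by (rule bij_betw_inv_into_right[OF bij that])
  have eq: "?w z = p" if "p \<in> carrier M" "v p = z" for p z
    using bij_betw_inv_into_left[OF bij that(1)] that(2) by simp
  have "?w \<in> module_hom R M M"
    unfolding module_hom_def
  proof (intro CollectI conjI ballI)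
    show "?w (a \<oplus>\<^bsub>M\<^esub> b) = ?w a \<oplus>\<^bsub>M\<^esub> ?w b" if "a \<in> carrier M" "b \<in> carrier M" for a b
      using that wc vw vh by (intro eq) auto
    show "?w (r \<odot>\<^bsub>M\<^esub> a) = r \<odot>\<^bsub>M\<^esub> ?w a" if "r \<in> carrier R" "a \<in> carrier M" for r a
      using that wc vw vh by (intro eq) auto
  qed (use wc in blast)
  then have "?w \<in> module_aut R M" using wbij unfolding module_aut_def by blast
  then have "?w (v y) \<in> N" using y(2) by (rule aut)
  then show ?thesis using eq[OF y(1) refl] by simp
qed

text \<open>\<open>1 + t\<close> is an automorphism with inverse \<open>1 - t\<close>.\<close>

lemma square_zero_closed:
  assumes t: "t \<in> module_hom R M M" and tt: "\<And>y. y \<in> carrier M \<Longrightarrow> t (t y) = \<zero>\<^bsub>M\<^esub>"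
    and n: "n \<in> N"
  shows "t n \<in> N"
proof -
  let ?v = "\<lambda>y. y \<oplus>\<^bsub>M\<^esub> t y"
  have v: "?v \<in> module_hom R M M" by (rule hom_plus[OF hom_id t])
  have "bij_betw ?v (carrier M) (carrier M)"
  proof (rule bij_betw_byWitness[where f' = "\<lambda>y. y \<ominus>\<^bsub>M\<^esub> t y"])
    show "\<forall>y\<in>carrier M. (y \<oplus>\<^bsub>M\<^esub> t y) \<ominus>\<^bsub>M\<^esub> t (y \<oplus>\<^bsub>M\<^esub> t y) = y" using t tt by simp
    show "\<forall>y\<in>carrier M. (y \<ominus>\<^bsub>M\<^esub> t y) \<oplus>\<^bsub>M\<^esub> t (y \<ominus>\<^bsub>M\<^esub> t y) = y" using t tt by simp
  qed (use t in auto)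
  then have "n \<oplus>\<^bsub>M\<^esub> t n \<in> N" using v n by (intro aut[of ?v]) (auto simp: module_aut_def)
  from diff_closed[OF this n] show ?thesis using t n by simp
qed

text \<open>The off-diagonal maps \<open>e f (1 - e)\<close> and \<open>(1 - e) f e\<close> have
  square zero, because their squares contain the factor \<open>(1 - e) e\<close> or
  \<open>e (1 - e)\<close>.\<close>

lemma corner_closed:
  assumes e: "e \<in> module_hom R M M" "\<And>y. y \<in> carrier M \<Longrightarrow> e (e y) = e y"
    and f: "f \<in> module_hom R M M" and n: "n \<in> N"
  shows "e (f (n \<ominus>\<^bsub>M\<^esub> e n)) \<in> N" and "f (e n) \<ominus>\<^bsub>M\<^esub> e (f (e n)) \<in> N"
proof -
  show "e (f (n \<ominus>\<^bsub>M\<^esub> e n)) \<in> N"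
  proof (rule square_zero_closed[OF _ _ n, where t = "\<lambda>y. e (f (y \<ominus>\<^bsub>M\<^esub> e y))"])
    show "(\<lambda>y. e (f (y \<ominus>\<^bsub>M\<^esub> e y))) \<in> module_hom R M M"
      by (rule hom_comp[OF e(1) hom_comp[OF f hom_diff[OF hom_id e(1)]]])
    show "e (f (e (f (y \<ominus>\<^bsub>M\<^esub> e y)) \<ominus>\<^bsub>M\<^esub> e (e (f (y \<ominus>\<^bsub>M\<^esub> e y))))) = \<zero>\<^bsub>M\<^esub>"
      if "y \<in> carrier M" for y
    proof -
      have "f (y \<ominus>\<^bsub>M\<^esub> e y) \<in> carrier M" using that e f by simp
      then show ?thesis using that e f by simp
    qed
  qed
  show "f (e n) \<ominus>\<^bsub>M\<^esub> e (f (e n)) \<in> N"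
  proof (rule square_zero_closed[OF _ _ n, where t = "\<lambda>y. f (e y) \<ominus>\<^bsub>M\<^esub> e (f (e y))"])
    show "(\<lambda>y. f (e y) \<ominus>\<^bsub>M\<^esub> e (f (e y))) \<in> module_hom R M M"
      by (rule hom_diff[OF hom_comp[OF f e(1)] hom_comp[OF e(1) hom_comp[OF f e(1)]]])
    show "f (e (f (e y) \<ominus>\<^bsub>M\<^esub> e (f (e y)))) \<ominus>\<^bsub>M\<^esub> e (f (e (f (e y) \<ominus>\<^bsub>M\<^esub> e (f (e y))))) = \<zero>\<^bsub>M\<^esub>"
      if "y \<in> carrier M" for y
    proof -
      have "e (f (e y) \<ominus>\<^bsub>M\<^esub> e (f (e y))) = \<zero>\<^bsub>M\<^esub>" using that e f by simp
      then show ?thesis using e f by simp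
    qed
  qed
qed

text \<open>The automorphism of \<open>hull_proj_aut\<close> sends \<open>e n\<close> to
  \<open>h (e n)\<close>, because its second summand vanishes on \<open>e M\<close>. Its inverse
  brings \<open>h (e n)\<close> back.\<close>

lemma proj_closed_if_inj:
  assumes e: "hull_proj e x" and h: "h \<in> module_hom R M M"
    and eh: "\<And>y. y \<in> carrier M \<Longrightarrow> e (h (e y)) = h (e y)"
    and inj: "\<And>y. y \<in> carrier M \<Longrightarrow> h (e y) = \<zero>\<^bsub>M\<^esub> \<Longrightarrow> e y = \<zero>\<^bsub>M\<^esub>"
    and n: "n \<in> N" "h (e n) \<in> N"
  shows "e n \<in> N"
proof (rule aut_reflects[OF hull_proj_aut[OF e h eh inj]])
  note D = hull_projD[OF e]
  show "h (e (e n)) \<oplus>\<^bsub>M\<^esub> (e n \<ominus>\<^bsub>M\<^esub> e (e n)) \<in> N" using n D(4,5) h by simp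
  show "e n \<in> carrier M" using n D(4) by simp
qed

text \<open>Here the same automorphism acts on \<open>n\<close> itself, and the part
  \<open>n - e n\<close> is subtracted.\<close>

lemma inj_closed_if_proj:
  assumes e: "hull_proj e x" and h: "h \<in> module_hom R M M"
    and eh: "\<And>y. y \<in> carrier M \<Longrightarrow> e (h (e y)) = h (e y)"
    and inj: "\<And>y. y \<in> carrier M \<Longrightarrow> h (e y) = \<zero>\<^bsub>M\<^esub> \<Longrightarrow> e y = \<zero>\<^bsub>M\<^esub>"
    and n: "n \<in> N" "e n \<in> N"
  shows "h (e n) \<in> N"
proof -
  have "h (e n) \<oplus>\<^bsub>M\<^esub> (n \<ominus>\<^bsub>M\<^esub> e n) \<in> N" by (rule aut[OF hull_proj_aut[OF e h eh inj] n(1)])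
  from diff_closed[OF this diff_closed[OF n]] show ?thesis using n h by simp
qed

text \<open>The automorphism \<open>r e + (1 - e)\<close> differs from the identity by
  \<open>(r - 1) e\<close>, so \<open>(r - 1) e n\<close> lies in \<open>N\<close>. The scalar
  \<open>r - 1\<close> is injective on \<open>e M\<close> too and can be cancelled.\<close>

lemma hull_proj_closed_scalar:
  assumes e: "hull_proj e x" and r: "r \<in> carrier R" "r \<odot>\<^bsub>M\<^esub> x \<noteq> \<zero>\<^bsub>M\<^esub>" "(r \<ominus> \<one>) \<odot>\<^bsub>M\<^esub> x \<noteq> \<zero>\<^bsub>M\<^esub>"
    and n: "n \<in> N"
  shows "e n \<in> N"
proof -
  note D = hull_projD[OF e]
  have s: "r \<ominus> \<one> \<in> carrier R" using r by simp
  have "r \<odot>\<^bsub>M\<^esub> e n \<oplus>\<^bsub>M\<^esub> (n \<ominus>\<^bsub>M\<^esub> e n) \<in> N"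
  proof (rule aut[OF hull_proj_aut[OF e, of "\<lambda>z. r \<odot>\<^bsub>M\<^esub> z"] n])
    show "(\<lambda>z. r \<odot>\<^bsub>M\<^esub> z) \<in> module_hom R M M" by (rule hom_scale[OF hom_id r(1)])
  qed (use r(1) D(4,5) hull_proj_scalar_inj[OF e r(1,2)] in auto)
  then have "(r \<odot>\<^bsub>M\<^esub> e n \<oplus>\<^bsub>M\<^esub> (n \<ominus>\<^bsub>M\<^esub> e n)) \<ominus>\<^bsub>M\<^esub> n \<in> N" using n by (rule diff_closed)
  also have "(r \<odot>\<^bsub>M\<^esub> e n \<oplus>\<^bsub>M\<^esub> (n \<ominus>\<^bsub>M\<^esub> e n)) \<ominus>\<^bsub>M\<^esub> n = (r \<ominus> \<one>) \<odot>\<^bsub>M\<^esub> e n"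
  proof -
    have "(r \<odot>\<^bsub>M\<^esub> e n \<oplus>\<^bsub>M\<^esub> (n \<ominus>\<^bsub>M\<^esub> e n)) \<ominus>\<^bsub>M\<^esub> n
        = (r \<odot>\<^bsub>M\<^esub> e n \<ominus>\<^bsub>M\<^esub> e n) \<oplus>\<^bsub>M\<^esub> (n \<ominus>\<^bsub>M\<^esub> n)"
      using r(1) n D(4) by (simp only: a_minus_def) (simp add: M.a_ac)
    also have "\<dots> = (r \<ominus> \<one>) \<odot>\<^bsub>M\<^esub> e n" using r(1) n D(4) by (simp add: smult_l_diff)
    finally show ?thesis .
  qed
  finally have *: "(r \<ominus> \<one>) \<odot>\<^bsub>M\<^esub> e n \<in> N" .
  show ?thesis
  proof (rule proj_closed_if_inj[OF e _ _ _ n, of "\<lambda>z. (r \<ominus> \<one>) \<odot>\<^bsub>M\<^esub> z"])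
    show "(\<lambda>z. (r \<ominus> \<one>) \<odot>\<^bsub>M\<^esub> z) \<in> module_hom R M M" by (rule hom_scale[OF hom_id s])
    show "(r \<ominus> \<one>) \<odot>\<^bsub>M\<^esub> e n \<in> N" by (rule *)
    show "e ((r \<ominus> \<one>) \<odot>\<^bsub>M\<^esub> e y) = (r \<ominus> \<one>) \<odot>\<^bsub>M\<^esub> e y" if "y \<in> carrier M" for y
      using that s D(4,5) by simp
    show "e y = \<zero>\<^bsub>M\<^esub>" if "y \<in> carrier M" "(r \<ominus> \<one>) \<odot>\<^bsub>M\<^esub> e y = \<zero>\<^bsub>M\<^esub>" for y
      by (rule hull_proj_scalar_inj[OF e s r(3) that])
  qed
qed

text \<open>If \<open>(1 - e) M\<close> contains a second copy of the cyclic module of \<open>x\<close>, then the composite of two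
  off-diagonal maps \<open>e M \<rightarrow> (1 - e) M \<rightarrow> e M\<close> is injective.\<close>

lemma hull_proj_closed_copy:
  assumes e: "hull_proj e x" and y: "y \<in> carrier M" "e y = \<zero>\<^bsub>M\<^esub>" "ann y = ann x" and n: "n \<in> N"
  shows "e n \<in> N"
proof -
  note D = hull_projD[OF e]
  obtain f where f: "f \<in> module_hom R M M" "f x = y" using extend_cyclic[OF D(2) y(1)] y(3) by blast
  obtain g where g: "g \<in> module_hom R M M" "g y = x" using extend_cyclic[OF y(1) D(2)] y(3) by blast
  \<comment> \<open>\<open>a\<close> is \<open>(1 - e) f\<close>; it still sends \<open>x\<close> to
    \<open>y\<close>, because \<open>e y = 0\<close>. Therefore \<open>h = e g a\<close> fixes
    \<open>x\<close> and is injective on \<open>e M\<close>.\<close>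
  define a where "a = (\<lambda>z. f z \<ominus>\<^bsub>M\<^esub> e (f z))"
  have a: "a \<in> module_hom R M M" unfolding a_def by (rule hom_diff[OF f(1) hom_comp[OF D(4) f(1)]])
  define h where "h = (\<lambda>z. e (g (a z)))"
  have h: "h \<in> module_hom R M M" unfolding h_def by (rule hom_comp[OF D(4) hom_comp[OF g(1) a]])
  have ax: "a x = y" unfolding a_def using f y by simp
  have hx: "h x = x" unfolding h_def ax using g D by simp
  have an: "a (e n) \<in> N" unfolding a_def using corner_closed(2)[OF D(4,5) f(1) n] .
  \<comment> \<open>Thus \<open>a (e n)\<close> equals its own \<open>(1 - e)\<close> component, and
    \<open>corner_closed\<close> applies to it directly.\<close>
  have "e (a (e n)) = \<zero>\<^bsub>M\<^esub>" unfolding a_def using f D(4,5) n by simp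
  then have hn: "h (e n) \<in> N"
    using corner_closed(1)[OF D(4,5) g(1) an] an unfolding h_def by simp
  show ?thesis
  proof (rule proj_closed_if_inj[OF e h _ _ n hn])
    show "e (h (e z)) = h (e z)" if "z \<in> carrier M" for z
      using that D(4,5) g a unfolding h_def by simp
    show "e z = \<zero>\<^bsub>M\<^esub>" if "z \<in> carrier M" "h (e z) = \<zero>\<^bsub>M\<^esub>" for z
      by (rule hull_proj_inj[OF e h _ that]) (simp add: hx)
  qed
qed

text \<open>The hypothesis \<open>scalar\<close> says that of two different associated primes at
  least one has residue ring with more than two elements. If neither a scalar nor a second copy of
  \<open>R x\<close> handles \<open>e\<close>, then every associated prime of
  \<open>(1 - e) M\<close> is of that kind. In that case \<open>(1 - e) n\<close> is shown to lie in
  \<open>N\<close>, and \<open>e n\<close> is the difference.\<close>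

lemma hull_proj_closed:
  assumes noeth: "noetherian_ring R"
    and scalar: "\<And>x y. prime_ann x \<Longrightarrow> prime_ann y \<Longrightarrow> ann y \<noteq> ann x \<Longrightarrow>
      \<exists>r\<in>carrier R. (r \<odot>\<^bsub>M\<^esub> x \<noteq> \<zero>\<^bsub>M\<^esub> \<and> (r \<ominus> \<one>) \<odot>\<^bsub>M\<^esub> x \<noteq> \<zero>\<^bsub>M\<^esub>) \<or>
        (r \<odot>\<^bsub>M\<^esub> y \<noteq> \<zero>\<^bsub>M\<^esub> \<and> (r \<ominus> \<one>) \<odot>\<^bsub>M\<^esub> y \<noteq> \<zero>\<^bsub>M\<^esub>)"
    and e: "hull_proj e x" and n: "n \<in> N"
  shows "e n \<in> N"
proof (cases "(\<exists>r\<in>carrier R. r \<odot>\<^bsub>M\<^esub> x \<noteq> \<zero>\<^bsub>M\<^esub> \<and> (r \<ominus> \<one>) \<odot>\<^bsub>M\<^esub> x \<noteq> \<zero>\<^bsub>M\<^esub>) \<or>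
    (\<exists>y\<in>carrier M. e y = \<zero>\<^bsub>M\<^esub> \<and> ann y = ann x)")
  case True
  then show ?thesis using hull_proj_closed_scalar[OF e _ _ _ n] hull_proj_closed_copy[OF e _ _ _ n] by blast
next
  case False
  note D = hull_projD[OF e]
  define c where "c = (\<lambda>y. y \<ominus>\<^bsub>M\<^esub> e y)"
  have c: "c \<in> module_hom R M M" unfolding c_def by (rule hom_diff[OF hom_id D(4)])
  have ec: "e (c y) = \<zero>\<^bsub>M\<^esub>" if "y \<in> carrier M" for y unfolding c_def using that D(4,5) by simp
  have c_id: "c y = y" if "y \<in> carrier M" "e y = \<zero>\<^bsub>M\<^esub>" for y unfolding c_def using that by simp
  have cc: "c (c y) = c y" if "y \<in> carrier M" for y using c_id ec that c by simp
  \<comment> \<open>The preimage \<open>m\<close> in \<open>N\<close> is carried through the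
    induction, since the projections split off are known to preserve \<open>N\<close> only when
    applied to its elements.\<close>
  have "\<forall>m\<in>N. y = c m \<longrightarrow> y \<in> N" if "y \<in> carrier M" for y
    using noeth that
  proof (induction y rule: ann_induct)
    case (less y)
    show ?case
    proof (intro ballI impI)
      fix m assume m: "m \<in> N" "y = c m"
      show "y \<in> N"
      proof (cases "y = \<zero>\<^bsub>M\<^esub>")
        case True
        then show ?thesis using submodule_zero[OF N] by simp
      next
        case y: False
        obtain s where s: "s \<in> carrier R" "prime_ann (s \<odot>\<^bsub>M\<^esub> y)"
          using exists_prime_multiple[OF noeth less.hyps y] by blast
        have cy: "c y = y" "e y = \<zero>\<^bsub>M\<^esub>" using m cc ec by simp_all
        have esy: "e (s \<odot>\<^bsub>M\<^esub> y) = \<zero>\<^bsub>M\<^esub>" using D(4) s(1) less.hyps cy(2) by simp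
        have csy: "c (s \<odot>\<^bsub>M\<^esub> y) = s \<odot>\<^bsub>M\<^esub> y" using c s(1) less.hyps cy(1) by simp
        obtain e' where e': "hull_proj e' (s \<odot>\<^bsub>M\<^esub> y)"
            "\<And>z. z \<in> carrier M \<Longrightarrow> c (e' z) = e' z" "\<And>z. z \<in> carrier M \<Longrightarrow> e' (c z) = e' z"
          using exists_hull_proj[OF s(2) c cc csy] by blast
        note D' = hull_projD[OF e'(1)]
        \<comment> \<open>\<open>s y\<close> is killed by \<open>e\<close>, so it is no second copy
          of the generator \<open>x\<close>. As no scalar serves \<open>x\<close>, the one supplied
          by \<open>scalar\<close> must serve \<open>s y\<close>.\<close>
        have "ann (s \<odot>\<^bsub>M\<^esub> y) \<noteq> ann x" using False D'(2) esy by blast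
        then obtain r where r: "r \<in> carrier R" "r \<odot>\<^bsub>M\<^esub> (s \<odot>\<^bsub>M\<^esub> y) \<noteq> \<zero>\<^bsub>M\<^esub>"
            "(r \<ominus> \<one>) \<odot>\<^bsub>M\<^esub> (s \<odot>\<^bsub>M\<^esub> y) \<noteq> \<zero>\<^bsub>M\<^esub>"
          using scalar[OF D(1) s(2)] False by blast
        have e'm: "e' m \<in> N" by (rule hull_proj_closed_scalar[OF e'(1) r m(1)])
        have e'y: "e' y = e' m" using e'(3)[of m] m by simp
        have "ann y \<subset> ann (y \<ominus>\<^bsub>M\<^esub> e' y)"
          by (rule ann_psubset_diff[OF D'(4) less.hyps s(1) D'(3,6)])
        \<comment> \<open>The identities \<open>c e' = e'\<close> and \<open>e' c = e'\<close> keep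
          the remainder of the form \<open>c m'\<close>, with \<open>m' = m - e' m\<close> in
          \<open>N\<close>.\<close>
        moreover have "y \<ominus>\<^bsub>M\<^esub> e' y = c (m \<ominus>\<^bsub>M\<^esub> e' m)"
          unfolding e'y using m c D'(4) e'(2)[of m] by simp
        moreover have "y \<ominus>\<^bsub>M\<^esub> e' y \<in> carrier M" using less.hyps D'(4) by simp
        ultimately have "y \<ominus>\<^bsub>M\<^esub> e' y \<in> N"
          using less.IH diff_closed[OF m(1) e'm] by blast
        from add_closed[OF this] show ?thesis using e'm e'y less.hyps D'(4) by fastforce
      qed
    qed
  qed
  from this[of "c n"] have "c n \<in> N" using n c by simp
  then have "n \<ominus>\<^bsub>M\<^esub> c n \<in> N" using n diff_closed by blast
  also have "n \<ominus>\<^bsub>M\<^esub> c n = e n"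
    unfolding c_def using n D(4) by (simp add: a_minus_def M.minus_add M.a_assoc[symmetric] M.r_neg)
  finally show ?thesis .
qed

text \<open>An endomorphism of the uniform module \<open>e M\<close> or its difference from the identity is injective.\<close>

lemma hull_proj_corner_closed:
  assumes e: "hull_proj e x" and f: "f \<in> module_hom R M M" and n: "n \<in> N" "e n \<in> N"
  shows "e (f (e n)) \<in> N"
proof -
  note D = hull_projD[OF e]
  let ?h = "\<lambda>z. e (f z)"
  have h: "?h \<in> module_hom R M M" by (rule hom_comp[OF D(4) f])
  have closed: "g (e n) \<in> N" if g: "g \<in> module_hom R M M" "\<And>z. z \<in> carrier M \<Longrightarrow> e (g (e z)) = g (e z)"
    and inj: "\<And>s. s \<in> carrier R \<Longrightarrow> s \<odot>\<^bsub>M\<^esub> x \<noteq> \<zero>\<^bsub>M\<^esub> \<Longrightarrow> s \<odot>\<^bsub>M\<^esub> g x \<noteq> \<zero>\<^bsub>M\<^esub>" for g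
    using inj_closed_if_proj[OF e g _ n] hull_proj_inj[OF e g(1) inj] by blast
  show ?thesis
  proof (cases "\<exists>s\<in>carrier R. s \<odot>\<^bsub>M\<^esub> x \<noteq> \<zero>\<^bsub>M\<^esub> \<and> s \<odot>\<^bsub>M\<^esub> e (f x) = \<zero>\<^bsub>M\<^esub>")
    case False
    then show ?thesis using closed[OF h] D(4,5) f by auto
  next
    case True
    then obtain s where s: "s \<in> carrier R" "s \<odot>\<^bsub>M\<^esub> x \<noteq> \<zero>\<^bsub>M\<^esub>" "s \<odot>\<^bsub>M\<^esub> e (f x) = \<zero>\<^bsub>M\<^esub>" by blast
    have "e n \<ominus>\<^bsub>M\<^esub> e (f (e n)) \<in> N"
    proof (rule closed)
      show "(\<lambda>z. z \<ominus>\<^bsub>M\<^esub> e (f z)) \<in> module_hom R M M" by (rule hom_diff[OF hom_id h])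
      show "e (e z \<ominus>\<^bsub>M\<^esub> e (f (e z))) = e z \<ominus>\<^bsub>M\<^esub> e (f (e z))" if "z \<in> carrier M" for z
        using that D(4,5) f by simp
      \<comment> \<open>If \<open>t\<close> kills \<open>x - e (f x)\<close>, then
        \<open>s t x = t s e (f x) = 0\<close>, although neither \<open>s\<close> nor
        \<open>t\<close> kills \<open>x\<close>.\<close>
      show "t \<odot>\<^bsub>M\<^esub> (x \<ominus>\<^bsub>M\<^esub> e (f x)) \<noteq> \<zero>\<^bsub>M\<^esub>" if t: "t \<in> carrier R" "t \<odot>\<^bsub>M\<^esub> x \<noteq> \<zero>\<^bsub>M\<^esub>" for t
      proof
        assume "t \<odot>\<^bsub>M\<^esub> (x \<ominus>\<^bsub>M\<^esub> e (f x)) = \<zero>\<^bsub>M\<^esub>"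
        then have "t \<odot>\<^bsub>M\<^esub> x = t \<odot>\<^bsub>M\<^esub> e (f x)"
          using t D(2,4) f by (simp add: smult_r_diff diff_eq_zero_iff)
        then have "s \<odot>\<^bsub>M\<^esub> (t \<odot>\<^bsub>M\<^esub> x) = t \<odot>\<^bsub>M\<^esub> (s \<odot>\<^bsub>M\<^esub> e (f x))"
          using smult_commute[of s t "e (f x)"] s(1) t(1) D(2,4) f by simp
        then show False
          using prime_ann_nonzero[OF D(1) s(1) t(1) s(2) t(2)] s(3) t(1) by simp
      qed
    qed
    from diff_closed[OF n(2) this] show ?thesis
      using n D(4) f by (simp add: a_minus_def M.minus_add M.a_assoc[symmetric] M.r_neg)
  qed
qed

text \<open>Noetherian induction on \<open>Ann y\<close>, with \<open>y\<close> split as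
  \<open>(y - e y) + e y\<close> for a hull projection \<open>e\<close> at a multiple of
  \<open>y\<close>. The first part has a strictly larger annihilator.\<close>

lemma endomorphism_closed:
  assumes noeth: "noetherian_ring R"
    and proj: "\<And>e x n. hull_proj e x \<Longrightarrow> n \<in> N \<Longrightarrow> e n \<in> N"
    and f: "f \<in> module_hom R M M" and n: "n \<in> N"
  shows "f n \<in> N"
proof -
  have "y \<in> N \<longrightarrow> f y \<in> N" if "y \<in> carrier M" for y
    using noeth that
  proof (induction y rule: ann_induct)
    case (less y)
    show ?case
    proof (cases "y = \<zero>\<^bsub>M\<^esub>")
      case True
      then show ?thesis using f by simp
    next
      case y0: False
      show ?thesis
      proof
        assume y: "y \<in> N"
        obtain s where s: "s \<in> carrier R" "prime_ann (s \<odot>\<^bsub>M\<^esub> y)"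
          using exists_prime_multiple[OF noeth less.hyps y0] by blast
        obtain e where e: "hull_proj e (s \<odot>\<^bsub>M\<^esub> y)"
          using exists_hull_proj[OF s(2) hom_id] by blast
        note D = hull_projD[OF e]
        have ey: "e y \<in> N" by (rule proj[OF e y])
        have "ann y \<subset> ann (y \<ominus>\<^bsub>M\<^esub> e y)"
          by (rule ann_psubset_diff[OF D(4) less.hyps s(1) D(3,6)])
        then have 1: "f (y \<ominus>\<^bsub>M\<^esub> e y) \<in> N"
          using less.IH[of "y \<ominus>\<^bsub>M\<^esub> e y"] diff_closed[OF y ey] by simp
        \<comment> \<open>\<open>f e\<close> is the sum of the off-diagonal map
          \<open>(1 - e) f e\<close> and the diagonal map \<open>e f e\<close>.\<close>
        have "f (e y) \<in> N"
          using add_closed[OF corner_closed(2)[OF D(4,5) f y] hull_proj_corner_closed[OF e f y ey]]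
            f D(4) less.hyps by simp
        with add_closed[OF 1 this] show "f y \<in> N" using f D(4) less.hyps by simp
      qed
    qed
  qed
  then show ?thesis using n by simp
qed

end

section \<open>Residue fields with two elements\<close>

text \<open>Read off along the projection from the integers, which kills 2 and so depends only on
  the remainder modulo 2.\<close>

lemma ZFact_2:
  shows "carrier (ZFact 2) = {\<zero>\<^bsub>ZFact 2\<^esub>, \<one>\<^bsub>ZFact 2\<^esub>}"
    and "\<one>\<^bsub>ZFact 2\<^esub> \<oplus>\<^bsub>ZFact 2\<^esub> \<one>\<^bsub>ZFact 2\<^esub> = \<zero>\<^bsub>ZFact 2\<^esub>"
proof -
  define I where "I = Idl\<^bsub>\<Z>\<^esub> {2}"
  define \<phi> where "\<phi> = (+>\<^bsub>\<Z>\<^esub>) I"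
  have I: "ideal I \<Z>" unfolding I_def by (rule int.genideal_ideal) simp
  have Z: "ZFact 2 = \<Z> Quot I" unfolding ZFact_def I_def ..
  interpret \<phi>: ring_hom_ring \<Z> "ZFact 2" \<phi>
    unfolding Z \<phi>_def by (rule ideal.rcos_ring_hom_ring[OF I])
  have surj: "carrier (ZFact 2) = range \<phi>"
    unfolding Z \<phi>_def FactRing_def A_RCOSETS_def' by auto
  have "2 \<in> I" unfolding I_def using int.genideal_self'[of 2] by simp
  then have two: "\<phi> 2 = \<zero>\<^bsub>ZFact 2\<^esub>"
    unfolding Z \<phi>_def using int.a_rcos_zero[OF I] by (simp add: FactRing_def)
  then show "\<one>\<^bsub>ZFact 2\<^esub> \<oplus>\<^bsub>ZFact 2\<^esub> \<one>\<^bsub>ZFact 2\<^esub> = \<zero>\<^bsub>ZFact 2\<^esub>"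
    using \<phi>.hom_add[of 1 1] \<phi>.hom_one by simp
  have "\<phi> k \<in> {\<zero>\<^bsub>ZFact 2\<^esub>, \<one>\<^bsub>ZFact 2\<^esub>}" for k
  proof -
    have "\<phi> k = \<phi> (2 * (k div 2) + k mod 2)" by simp
    also have "\<dots> = \<phi> (k mod 2)"
      using \<phi>.hom_add[of "2 * (k div 2)" "k mod 2"] \<phi>.hom_mult[of 2 "k div 2"] two by simp
    also have "\<dots> \<in> {\<zero>\<^bsub>ZFact 2\<^esub>, \<one>\<^bsub>ZFact 2\<^esub>}"
      using \<phi>.hom_zero \<phi>.hom_one by (cases "even k") (auto simp: odd_iff_mod_2_eq_one)
    finally show ?thesis .
  qed
  moreover have S01: "\<zero>\<^bsub>ZFact 2\<^esub> \<in> range \<phi>" "\<one>\<^bsub>ZFact 2\<^esub> \<in> range \<phi>"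
    using rangeI[of \<phi> 0] rangeI[of \<phi> 1] \<phi>.hom_zero \<phi>.hom_one by simp_all
  ultimately show "carrier (ZFact 2) = {\<zero>\<^bsub>ZFact 2\<^esub>, \<one>\<^bsub>ZFact 2\<^esub>}"
    unfolding surj using S01 by blast
qed

context module
begin

text \<open>By \<open>bad\<close> every scalar kills or fixes \<open>x\<close>, so
  \<open>R / Ann x\<close> has two elements. The map is the reduction modulo \<open>Ann x\<close>
  followed by the unital map from the field with two elements to \<open>S\<close>.\<close>

lemma ring_hom_if_ann:
  assumes x: "x \<in> carrier M" "x \<noteq> \<zero>\<^bsub>M\<^esub>"
    and bad: "\<And>r. r \<in> carrier R \<Longrightarrow> r \<odot>\<^bsub>M\<^esub> x = \<zero>\<^bsub>M\<^esub> \<or> (r \<ominus> \<one>) \<odot>\<^bsub>M\<^esub> x = \<zero>\<^bsub>M\<^esub>"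
    and S: "cring S" "\<one>\<^bsub>S\<^esub> \<oplus>\<^bsub>S\<^esub> \<one>\<^bsub>S\<^esub> = \<zero>\<^bsub>S\<^esub>"
  shows "(\<lambda>r. if r \<in> ann x then \<zero>\<^bsub>S\<^esub> else \<one>\<^bsub>S\<^esub>) \<in> ring_hom R S"
proof -
  interpret S: cring S by fact
  have fix_or_kill: "r \<odot>\<^bsub>M\<^esub> x = (if r \<in> ann x then \<zero>\<^bsub>M\<^esub> else x)" if "r \<in> carrier R" for r
    using bad[OF that] that x unfolding ann_def by (auto simp: smult_l_diff diff_eq_zero_iff)
  \<comment> \<open>For the scalar 2 the second alternative of \<open>bad\<close> would say that
    \<open>x\<close> is zero.\<close>
  have "(\<one> \<oplus> \<one>) \<odot>\<^bsub>M\<^esub> x = \<zero>\<^bsub>M\<^esub>"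
  proof -
    have "((\<one> \<oplus> \<one>) \<ominus> \<one>) \<odot>\<^bsub>M\<^esub> x = x" using x by (simp add: smult_l_diff smult_l_distr)
    then show ?thesis using bad[of "\<one> \<oplus> \<one>"] x by auto
  qed
  then have xx: "x \<oplus>\<^bsub>M\<^esub> x = \<zero>\<^bsub>M\<^esub>" using x by (simp add: smult_l_distr)
  have in_ann: "r \<in> ann x \<longleftrightarrow> r \<odot>\<^bsub>M\<^esub> x = \<zero>\<^bsub>M\<^esub>" if "r \<in> carrier R" for r
    using that unfolding ann_def by simp
  have add: "r \<oplus> s \<in> ann x \<longleftrightarrow> (r \<in> ann x \<longleftrightarrow> s \<in> ann x)" if "r \<in> carrier R" "s \<in> carrier R" for r s
    using that x xx fix_or_kill[of r] fix_or_kill[of s] by (subst in_ann) (auto simp: smult_l_distr)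
  have mult: "r \<otimes> s \<in> ann x \<longleftrightarrow> r \<in> ann x \<or> s \<in> ann x" if "r \<in> carrier R" "s \<in> carrier R" for r s
    using that x fix_or_kill[of r] fix_or_kill[of s] by (subst in_ann) (auto simp: smult_assoc1)
  have "\<one> \<notin> ann x" using x unfolding ann_def by simp
  then show ?thesis using add mult S(2) by (intro ring_hom_memI) auto
qed

text \<open>The Chinese remainder theorem for two different maximal ideals with residue field of two
  elements.\<close>

lemma has_homomorphic_image_if_ann_neq:
  assumes x: "x \<in> carrier M" "x \<noteq> \<zero>\<^bsub>M\<^esub>"
    and bad_x: "\<And>r. r \<in> carrier R \<Longrightarrow> r \<odot>\<^bsub>M\<^esub> x = \<zero>\<^bsub>M\<^esub> \<or> (r \<ominus> \<one>) \<odot>\<^bsub>M\<^esub> x = \<zero>\<^bsub>M\<^esub>"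
    and y: "y \<in> carrier M" "y \<noteq> \<zero>\<^bsub>M\<^esub>"
    and bad_y: "\<And>r. r \<in> carrier R \<Longrightarrow> r \<odot>\<^bsub>M\<^esub> y = \<zero>\<^bsub>M\<^esub> \<or> (r \<ominus> \<one>) \<odot>\<^bsub>M\<^esub> y = \<zero>\<^bsub>M\<^esub>"
    and neq: "ann x \<noteq> ann y"
  shows "has_homomorphic_image R (RDirProd (ZFact 2) (ZFact 2))"
proof -
  let ?S = "ZFact 2"
  interpret S: cring ?S by (rule ZFact_is_cring)
  let ?\<chi> = "\<lambda>z r. if r \<in> ann z then \<zero>\<^bsub>?S\<^esub> else \<one>\<^bsub>?S\<^esub>"
  let ?h = "\<lambda>r. (?\<chi> x r, ?\<chi> y r)"
  have \<chi>: "?\<chi> x \<in> ring_hom R ?S" "?\<chi> y \<in> ring_hom R ?S"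
    by (rule ring_hom_if_ann[OF x bad_x S.is_cring ZFact_2(2)], assumption)
      (rule ring_hom_if_ann[OF y bad_y S.is_cring ZFact_2(2)], assumption)
  have "ring (RDirProd ?S ?S)" by (rule RDirProd_ring[OF S.ring_axioms S.ring_axioms])
  moreover have h: "?h \<in> ring_hom R (RDirProd ?S ?S)"
    using \<chi> unfolding ring_hom_def RDirProd_def DirProd_def by (auto simp: monoid.defs)
  ultimately interpret h: ring_hom_ring R "RDirProd ?S ?S" ?h
    by (intro ring_hom_ringI2 R.ring_axioms)
  \<comment> \<open>An element of exactly one of the two annihilators. By \<open>compl\<close>,
    \<open>1 - r\<close> lies in exactly the other one, so 0, 1, \<open>r\<close> and
    \<open>1 - r\<close> reach all four pairs.\<close>
  obtain r where r: "r \<in> carrier R" "(r \<in> ann x \<and> r \<notin> ann y) \<or> (r \<notin> ann x \<and> r \<in> ann y)"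
    using neq unfolding ann_def by blast
  have compl: "\<one> \<ominus> r \<in> ann z \<longleftrightarrow> r \<notin> ann z"
    if "z \<in> carrier M" "z \<noteq> \<zero>\<^bsub>M\<^esub>" "r \<odot>\<^bsub>M\<^esub> z = \<zero>\<^bsub>M\<^esub> \<or> (r \<ominus> \<one>) \<odot>\<^bsub>M\<^esub> z = \<zero>\<^bsub>M\<^esub>" for z
    using that r(1) unfolding ann_def by (auto simp: smult_l_diff diff_eq_zero_iff)
  note c = compl[OF x bad_x[OF r(1)]] compl[OF y bad_y[OF r(1)]]
  have zero: "\<zero> \<in> ann x" "\<zero> \<in> ann y" and one: "\<one> \<notin> ann x" "\<one> \<notin> ann y"
    using x y unfolding ann_def by auto
  have "?h ` {\<zero>, \<one>, r, \<one> \<ominus> r} = {\<zero>\<^bsub>?S\<^esub>, \<one>\<^bsub>?S\<^esub>} \<times> {\<zero>\<^bsub>?S\<^esub>, \<one>\<^bsub>?S\<^esub>}"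
    using r(2) zero one c by auto
  then have "carrier (RDirProd ?S ?S) \<subseteq> ?h ` carrier R"
    unfolding RDirProd_carrier ZFact_2(1) using r(1)
    by (metis (no_types, lifting) R.minus_closed R.one_closed R.zero_closed empty_subsetI image_mono insert_subset)
  moreover have "?h ` carrier R \<subseteq> carrier (RDirProd ?S ?S)"
    using h.hom_closed by (rule image_subsetI)
  ultimately have "R Quot a_kernel R (RDirProd ?S ?S) ?h \<simeq> RDirProd ?S ?S"
    by (intro h.FactRing_iso equalityI)
  then show ?thesis unfolding has_homomorphic_image_def using h.kernel_is_ideal by blast
qed

end

section \<open>Application to the image of \<open>M\<close> in its injective envelope\<close>

theorem corollary4p6:
  fixes R :: "('a, 'm) ring_scheme"
    and M :: "('a, 'b, 'k) module_scheme"
    and E :: "('a, 'e, 'l) module_scheme"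
    and j :: "'b \<Rightarrow> 'e"
  assumes "cring R" and "noetherian_ring R"
    and "\<not> has_homomorphic_image R (RDirProd (ZFact 2) (ZFact 2))"
    and "module R M"
    and "injective_envelope R M E j"
    and "automorphism_invariant R M E j"
  shows "quasi_injective R M E j"
proof -
  have inj: "injective_module R E" and j: "j \<in> module_hom R M E"
    using assms(5) unfolding injective_envelope_def by auto
  have "module R E" using inj unfolding injective_module_def injective_wrt_def by blast
  then interpret E: injective_mod R E by (intro injective_mod.intro injective_mod_axioms.intro inj)
  interpret M: module R M by fact
  have "submodule (j ` carrier M) R E"
  proof (rule E.submoduleI)
    have jc: "j a \<in> carrier E" and jadd: "j (a \<oplus>\<^bsub>M\<^esub> b) = j a \<oplus>\<^bsub>E\<^esub> j b"
      and jsm: "j (r \<odot>\<^bsub>M\<^esub> a) = r \<odot>\<^bsub>E\<^esub> j a"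
      if "a \<in> carrier M" "b \<in> carrier M" "r \<in> carrier R" for a b r
      using j that unfolding module_hom_def by auto
    show sub: "j ` carrier M \<subseteq> carrier E" using jc by blast
    show add: "a \<oplus>\<^bsub>E\<^esub> b \<in> j ` carrier M" if ab: "a \<in> j ` carrier M" "b \<in> j ` carrier M" for a b
    proof -
      obtain p q where "p \<in> carrier M" "a = j p" "q \<in> carrier M" "b = j q" using ab by blast
      then show ?thesis using jadd[of p q "\<zero>\<^bsub>R\<^esub>"] by (intro image_eqI[of _ _ "p \<oplus>\<^bsub>M\<^esub> q"]) auto
    qed
    show smult: "r \<odot>\<^bsub>E\<^esub> a \<in> j ` carrier M" if ra: "r \<in> carrier R" "a \<in> j ` carrier M" for r a
    proof -
      obtain p where "p \<in> carrier M" "a = j p" using ra by blast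
      then show ?thesis using jsm[of p p r] ra by (intro image_eqI[of _ _ "r \<odot>\<^bsub>M\<^esub> p"]) auto
    qed
    show "\<ominus>\<^bsub>E\<^esub> a \<in> j ` carrier M" if a: "a \<in> j ` carrier M" for a
    proof -
      have "\<ominus>\<^bsub>E\<^esub> a = (\<ominus>\<^bsub>R\<^esub> \<one>\<^bsub>R\<^esub>) \<odot>\<^bsub>E\<^esub> a"
        using a sub E.smult_l_minus[of "\<one>\<^bsub>R\<^esub>" a] by auto
      then show ?thesis using smult[OF _ a] by simp
    qed
    show "\<zero>\<^bsub>E\<^esub> \<in> j ` carrier M"
      using smult[of "\<zero>\<^bsub>R\<^esub>" "j \<zero>\<^bsub>M\<^esub>"] jc[of "\<zero>\<^bsub>M\<^esub>" "\<zero>\<^bsub>M\<^esub>" "\<zero>\<^bsub>R\<^esub>"] by auto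
  qed
  moreover have "f x \<in> j ` carrier M" if "f \<in> module_aut R E" "x \<in> j ` carrier M" for f x
    using assms(6) that unfolding automorphism_invariant_def by blast
  ultimately interpret E: aut_invariant R E "j ` carrier M"
    by (intro aut_invariant.intro aut_invariant_axioms.intro E.injective_mod_axioms)
  \<comment> \<open>The excluded image enters here: if no \<open>r\<close> served \<open>x\<close>
    or \<open>y\<close>, both residue rings would have two elements, and the different annihilators
    would yield that image.\<close>
  have scalar: "\<exists>r\<in>carrier R.
      (r \<odot>\<^bsub>E\<^esub> x \<noteq> \<zero>\<^bsub>E\<^esub> \<and> (r \<ominus>\<^bsub>R\<^esub> \<one>\<^bsub>R\<^esub>) \<odot>\<^bsub>E\<^esub> x \<noteq> \<zero>\<^bsub>E\<^esub>) \<or>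
      (r \<odot>\<^bsub>E\<^esub> y \<noteq> \<zero>\<^bsub>E\<^esub> \<and> (r \<ominus>\<^bsub>R\<^esub> \<one>\<^bsub>R\<^esub>) \<odot>\<^bsub>E\<^esub> y \<noteq> \<zero>\<^bsub>E\<^esub>)"
    if "E.prime_ann x" "E.prime_ann y" "E.ann y \<noteq> E.ann x" for x y
    using E.has_homomorphic_image_if_ann_neq[of x y] assms(3) that unfolding E.prime_ann_def by metis
  have proj: "e n \<in> j ` carrier M" if "E.hull_proj e x" "n \<in> j ` carrier M" for e x n
    by (rule E.hull_proj_closed[OF assms(2) _ that]) (rule scalar)
  have "f n \<in> j ` carrier M" if "f \<in> module_hom R E E" "n \<in> j ` carrier M" for f n
    by (rule E.endomorphism_closed[OF assms(2) _ that]) (rule proj)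
  then show ?thesis unfolding quasi_injective_def by blast
qed

end
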